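(* For $\Delta\in\mathbb R_{>0}$ let $\operatorname{IWR}(\Delta)$ be the set of all integral well-rounded lattices in $\mathbb R^2$ with determinant $\Delta$, considered up to rotation and reflection (i.e. up to orthogonal transformations). Then $\operatorname{IWR}(\Delta)$ is finite for every $\Delta$, and it is nonempty only if $\Delta=M\sqrt D$ with $M,D$ positive integers, $D$ squarefree, and the set $$\operatorname{mn}(M)=\left\{(m,n)\in\mathbb Z_{>0}^2:\ \gcd(m,n)=1,\ \sqrt{\tfrac D3}\le \tfrac mn\le\sqrt{3D},\ \tfrac{2mn}{2^e\gcd(m,D)}\ \Big|\ M\right\}$$ nonempty (where $e$ equals $0$ if either $2\mid D$, or ($2\mid D+1$ and $2\mid mn$), and equals $1$ otherwise). In this latter case, $$|\operatorname{IWR}(\Delta)|\le\frac12\sum_{r\mid M}2^{\omega(rD)},$$ and moreover $$|\operatorname{IWR}(\Delta)|\ll\sum_{r\mid M}\sum_{g\mid r}\mu\!\left(\frac rg\right)\frac{\tau(g^2D)}{\sqrt{\omega(gD)}},$$ where the implied constant does not depend on $\Delta$.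
   Context: A full-rank lattice $\Lambda=A\mathbb Z^2$ is integral if $A^tA$ has integer entries, $\det\Lambda=|\det A|$, and it is well-rounded if the vectors of minimal Euclidean length in $\Lambda\setminus\{0\}$ span $\mathbb R^2$. $\tau(u)$ is the number of positive divisors of $u$, $\omega(u)$ the number of distinct prime divisors, and $\mu$ the Möbius function; sums over $r\mid M$, $g\mid r$ are over positive divisors.
   Formalization: The explicit bound is stated for Δ ≠ 1, since at Δ = 1 its right side is 1/2 while Z² gives |IWR(1)| = 1; in the last bound the undefined quotient τ(g²D)/√ω(gD) at g = D = 1 is read as 1. *)

theory Defs
  imports "HOL-Analysis.Analysis" "HOL-Computational_Algebra.Computational_Algebra"
begin

definition lattice_of :: "real^2^2 \<Rightarrow> (real^2) set" where
  "lattice_of A = {A *v z | z. \<forall>i. z $ i \<in> \<int>}"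

definition minimal_vectors :: "(real^2) set \<Rightarrow> (real^2) set" where
  "minimal_vectors L = {x \<in> L - {0}. \<forall>y \<in> L - {0}. norm x \<le> norm y}"

definition well_rounded :: "(real^2) set \<Rightarrow> bool" where
  "well_rounded L \<longleftrightarrow> span (minimal_vectors L) = UNIV"

(* Neither integrality of the Gram matrix nor |det A| depends on the chosen basis matrix A of L,
   since two basis matrices differ by an integer matrix of determinant 1 or -1. *)
definition iwr_lattices :: "real \<Rightarrow> (real^2) set set" where
  "iwr_lattices \<Delta> = {L. well_rounded L \<and>
     (\<exists>A. det A \<noteq> 0 \<and> L = lattice_of A \<and> (\<forall>i j. (transpose A ** A) $ i $ j \<in> \<int>) \<and> \<bar>det A\<bar> = \<Delta>)}"

definition isometry_rel :: "real \<Rightarrow> ((real^2) set \<times> (real^2) set) set" where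
  "isometry_rel \<Delta> = {(L, L'). L \<in> iwr_lattices \<Delta> \<and> L' \<in> iwr_lattices \<Delta> \<and>
     (\<exists>U. orthogonal_matrix U \<and> L' = (\<lambda>x. U *v x) ` L)}"

definition IWR :: "real \<Rightarrow> (real^2) set set set" where
  "IWR \<Delta> = iwr_lattices \<Delta> // isometry_rel \<Delta>"

definition parity_exponent :: "nat \<Rightarrow> nat \<Rightarrow> nat \<Rightarrow> nat" where
  "parity_exponent D m n = (if 2 dvd D \<or> (2 dvd D + 1 \<and> 2 dvd m * n) then 0 else 1)"

(* The division is exact, because 2 ^ e divides 2 and gcd m D divides m. *)
definition mn_set :: "nat \<Rightarrow> nat \<Rightarrow> (nat \<times> nat) set" where
  "mn_set D M = {(m, n). m > 0 \<and> n > 0 \<and> gcd m n = 1 \<and>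
     sqrt (real D / 3) \<le> real m / real n \<and> real m / real n \<le> sqrt (3 * real D) \<and>
     (2 * m * n) div (2 ^ parity_exponent D m n * gcd m D) dvd M}"

definition tau :: "nat \<Rightarrow> nat" where
  "tau u = card {d. d dvd u}"

definition omega :: "nat \<Rightarrow> nat" where
  "omega u = card {p. prime p \<and> p dvd u}"

definition mu :: "nat \<Rightarrow> int" where
  "mu u = (if squarefree u then (-1) ^ omega u else 0)"

(* The factor sqrt (omega (g * D)) vanishes exactly for g = D = 1; there the quotient
   tau (g\<^sup>2 * D) / sqrt (omega (g * D)) is given the value 1.  This choice matters only for
   M = D = 1: if D = 1 < M, the g = 1 terms carry the total weight (\<Sum>r | r dvd M. mu r) = 0. *)
definition divisor_weight :: "nat \<Rightarrow> nat \<Rightarrow> real" where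
  "divisor_weight D g = real (tau (g\<^sup>2 * D)) / sqrt (real (max 1 (omega (g * D))))"

(* For \<Delta> = 1, i.e. M = D = 1, the bound (1/2) * (\<Sum>r | r dvd M. 2 ^ omega (r * D)) equals 1/2, while
   IWR 1 contains the class of the standard lattice; so that bound can hold only for \<Delta> \<noteq> 1. *)

end

theory Submission
  imports Defs
begin

text \<open>A well-rounded lattice has a basis of minimal vectors with Gram matrix \<open>[[a, b], [b, a]]\<close>,
  \<open>0 \<le> 2b \<le> a\<close>, so its isometry class is determined by the divisor \<open>u = a - b\<close> of
  \<open>N = \<Delta>\<^sup>2 = M\<^sup>2 D\<close>, where \<open>u \<le> N / u \<le> 3u\<close>.

  The map \<open>u \<mapsto> N / u\<close> shows that there are at most \<open>\<tau>(N) / 2\<close> such \<open>u\<close>. Grouping the divisors by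
  \<open>gcd u (N / u) = M / r\<close> leaves coprime factorizations of \<open>r\<^sup>2 D\<close>, which correspond to
  sets of primes; this gives the first bound.

  In the second bound the double sum collapses to its term \<open>r = g = M\<close> by Moebius inversion. Two
  admissible \<open>u\<close> have a quotient less than 2, so they form an antichain for divisibility. The
  divisors of \<open>N\<close> are covered by few chains: grouping the exponents of each prime into
  pairs (leaving at most a third of them single) splits the divisor lattice into Boolean
  lattices, whose symmetric chain decompositions are built up one prime at a time.\<close>

section \<open>Sums over divisors\<close>

lemma omega_prime_power_mult:
  assumes "prime p" "\<not> p dvd n" "n > 0" "e > 0"
  shows "omega (p ^ e * n) = Suc (omega n)"
proof -
  have "{q. prime q \<and> q dvd p ^ e * n} = insert p {q. prime q \<and> q dvd n}"
  proof -
    have "q dvd p ^ e \<longleftrightarrow> q = p" if "prime q" for q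
      using that assms by (metis prime_dvd_power primes_dvd_imp_eq dvd_power)
    then show ?thesis using assms(1) by (auto simp: prime_dvd_mult_iff)
  qed
  moreover have "finite {q. prime q \<and> q dvd n}"
    using assms(3) by (intro finite_subset[OF _ finite_divisors_nat[of n]]) auto
  ultimately show ?thesis using assms by (simp add: omega_def)
qed

section \<open>Moebius function and inversion over divisors\<close>

lemma mu_prime_mult:
  assumes "prime p" "\<not> p dvd d" "d > 0"
  shows "mu (p * d) = - mu d"
proof -
  have "coprime p d" using assms by (simp add: prime_imp_coprime)
  then have "squarefree (p * d) \<longleftrightarrow> squarefree d"
    using assms squarefree_mult_coprime[of p d] squarefree_multD[of p d] squarefree_prime[of p] 
    by auto
  then show ?thesis using omega_prime_power_mult[OF assms, of 1] by (simp add: mu_def)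
qed

text \<open>For a prime \<open>p\<close> dividing \<open>n\<close>, multiplication by
  \<open>p\<close> matches the squarefree divisors not divisible by \<open>p\<close> with those
  divisible by it and flips the sign of \<open>mu\<close>, so the sum cancels.\<close>

lemma sum_mu_divisors:
  assumes "n > 0"
  shows "(\<Sum>d | d dvd n. mu d) = (if n = 1 then 1 else 0)"
proof (cases "n = 1")
  case True
  have "{p::nat. prime p \<and> p dvd 1} = {}" by auto
  then have "mu 1 = 1" by (simp only: mu_def omega_def) simp
  then show ?thesis using True by simp
next
  case False
  then obtain p where p: "prime p" "p dvd n" using prime_factor_nat by blast
  have pos: "p > 0" using p(1) prime_gt_0_nat by blast
  define P where "P = {d. d dvd n \<and> \<not> p dvd d \<and> squarefree d}"
  define Q where "Q = {d. d dvd n \<and> p dvd d \<and> squarefree d}"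
  have fin: "finite {d. d dvd n}" using assms by simp
  have "Q = (*) p ` P"
  proof (intro set_eqI iffI)
    fix d assume "d \<in> Q"
    then obtain k where k: "d = p * k" by (auto simp: Q_def)
    have "squarefree (p * k)" "p * k dvd n" using \<open>d \<in> Q\<close> k by (auto simp: Q_def)
    moreover from this(1) have "\<not> p dvd k" using p(1)
      by (metis mult_dvd_mono dvd_refl power2_eq_square squarefreeD not_prime_unit)
    moreover have "squarefree k" using squarefree_multD \<open>squarefree (p * k)\<close> by blast
    ultimately have "k \<in> P" by (auto simp: P_def intro: dvd_mult_right)
    then show "d \<in> (*) p ` P" using k by blast
  next
    fix d assume "d \<in> (*) p ` P"
    then obtain k where k: "d = p * k" "k dvd n" "\<not> p dvd k" "squarefree k" by (auto simp: P_def)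
    have cop: "coprime p k" using p(1) k(3) by (simp add: prime_imp_coprime)
    then have "p * k dvd n" using p(2) k(2) by (simp add: divides_mult)
    moreover have "squarefree (p * k)"
      using cop k(4) p(1) by (simp add: squarefree_mult_coprime squarefree_prime)
    ultimately show "d \<in> Q" using k(1) by (simp add: Q_def)
  qed
  then have "sum mu Q = (\<Sum>d\<in>P. mu (p * d))"
    using pos by (simp add: sum.reindex inj_on_def)
  also have "\<dots> = (\<Sum>d\<in>P. - mu d)"
    using p(1) by (intro sum.cong refl mu_prime_mult) (auto simp: P_def intro: Nat.gr0I)
  finally have "sum mu Q = - sum mu P" by (simp add: sum_negf)
  moreover have "(\<Sum>d | d dvd n. mu d) = sum mu (P \<union> Q)"
    using fin by (intro sum.mono_neutral_right) (auto simp: P_def Q_def mu_def)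
  moreover have "sum mu (P \<union> Q) = sum mu P + sum mu Q"
    using fin by (intro sum.union_disjoint) (auto simp: P_def Q_def)
  ultimately show ?thesis using False by simp
qed

text \<open>Writing \<open>r = g * k\<close> and exchanging the sums leaves, for each
  \<open>g\<close>, the sum of \<open>mu\<close> over the divisors of \<open>n div g\<close>, which
  vanishes unless \<open>g = n\<close>.\<close>

lemma moebius_inversion:
  fixes f :: "nat \<Rightarrow> real"
  assumes "n > 0"
  shows "(\<Sum>r | r dvd n. \<Sum>g | g dvd r. of_int (mu (r div g)) * f g) = f n"
proof -
  have pos: "0 < r" if "r dvd n" for r using that assms by (rule dvd_pos_nat[rotated])
  have "(\<Sum>r | r dvd n. \<Sum>g | g dvd r. of_int (mu (r div g)) * f g)
      = (\<Sum>(r, g)\<in>(SIGMA r:{r. r dvd n}. {g. g dvd r}). of_int (mu (r div g)) * f g)"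
    using assms pos by (intro sum.Sigma) auto
  also have "\<dots> = (\<Sum>(g, k)\<in>(SIGMA g:{g. g dvd n}. {k. k dvd n div g}). of_int (mu k) * f g)"
  proof (rule sum.reindex_bij_witness[of _ "\<lambda>(g, k). (g * k, g)" "\<lambda>(r, g). (g, r div g)"])
    fix x assume x: "x \<in> (SIGMA r:{r. r dvd n}. {g. g dvd r})"
    obtain g k m where [simp]: "x = (g * k, g)" "n = g * k * m"
      using x by (auto elim!: dvdE)
    have [simp]: "g > 0" using assms by (simp add: Nat.gr0I)
    show "(case case x of (r, g) \<Rightarrow> (g, r div g) of (g, k) \<Rightarrow> (g * k, g)) = x" by simp
    show "(case x of (r, g) \<Rightarrow> (g, r div g)) \<in> (SIGMA g:{g. g dvd n}. {k. k dvd n div g})"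
      by (simp add: mult.assoc)
    show "(case case x of (r, g) \<Rightarrow> (g, r div g) of (g, k) \<Rightarrow> of_int (mu k) * f g)
        = (case x of (r, g) \<Rightarrow> of_int (mu (r div g)) * f g)" by simp
  next
    fix y assume y: "y \<in> (SIGMA g:{g. g dvd n}. {k. k dvd n div g})"
    obtain g k where gk [simp]: "y = (g, k)" "g dvd n" "k dvd n div g" using y by auto
    have [simp]: "g > 0" using pos by simp
    show "(case case y of (g, k) \<Rightarrow> (g * k, g) of (r, g) \<Rightarrow> (g, r div g)) = y" by simp
    have "g * k dvd g * (n div g)" using gk(3) by (rule mult_dvd_mono[OF dvd_refl])
    then show "(case y of (g, k) \<Rightarrow> (g * k, g)) \<in> (SIGMA r:{r. r dvd n}. {g. g dvd r})" by simp
  qed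
  also have "\<dots> = (\<Sum>g | g dvd n. \<Sum>k | k dvd n div g. of_int (mu k) * f g)"
    using assms pos by (intro sum.Sigma[symmetric]) (auto simp: dvd_div_eq_0_iff)
  also have "\<dots> = (\<Sum>g | g dvd n. if g = n then f g else 0)"
  proof (intro sum.cong refl)
    fix g assume "g \<in> {g. g dvd n}"
    then have g: "g dvd n" "g > 0" using pos by auto
    then have "n div g > 0" "n div g = 1 \<longleftrightarrow> g = n"
      using assms by (auto simp: dvd_div_eq_iff div_greater_zero_iff dvd_imp_le)
    then have "(\<Sum>k | k dvd n div g. mu k) = (if g = n then 1 else 0)"
      using sum_mu_divisors[of "n div g"] by simp
    then have "real_of_int (\<Sum>k | k dvd n div g. mu k) = (if g = n then 1 else 0)" by simp
    then have "(\<Sum>k | k dvd n div g. real_of_int (mu k)) = (if g = n then 1 else 0)" by simp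
    then show "(\<Sum>k | k dvd n div g. of_int (mu k) * f g) = (if g = n then f g else 0)"
      by (simp add: sum_distrib_right[symmetric])
  qed
  also have "\<dots> = f n" using assms by (subst sum.delta) auto
  finally show ?thesis .
qed

text \<open>After the gcd with \<open>M\<close> is removed from \<open>c\<close>, the square of the
  cofactor is coprime to the square of the reduced \<open>M\<close>. It therefore divides the
  squarefree \<open>D\<close>, which forces the cofactor to be 1.\<close>

lemma dvd_of_square_dvd_squarefree:
  fixes c M D :: nat
  assumes "c\<^sup>2 dvd M\<^sup>2 * D" "squarefree D" "M > 0"
  shows "c dvd M"
proof -
  define g where "g = gcd c M"
  have g: "g > 0" using assms(3) by (simp add: g_def)
  obtain c' M' where c: "c = g * c'" "M = g * M'" "coprime c' M'"
    using gcd_coprime_exists[of c M] g unfolding g_def by (metis mult.commute less_irrefl)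
  have "g\<^sup>2 * c'\<^sup>2 dvd g\<^sup>2 * (M'\<^sup>2 * D)" using assms(1) c by (simp add: power_mult_distrib mult.assoc)
  then have "c'\<^sup>2 dvd M'\<^sup>2 * D" using g by simp
  moreover have "coprime (c'\<^sup>2) (M'\<^sup>2)" using c(3) by simp
  ultimately have "c'\<^sup>2 dvd D" by (simp add: coprime_dvd_mult_right_iff)
  then have "c' = 1" using assms(2) squarefreeD by fastforce
  then show ?thesis using c by simp
qed

text \<open>A divisor \<open>u\<close> is encoded by \<open>M div c u\<close> and the primes of
  \<open>u div c u\<close>. The first recovers \<open>c u\<close>; the second recovers
  \<open>u div c u\<close>, because in a coprime factorization of a fixed number each prime goes
  entirely to one factor.\<close>

lemma tau_square_mult_le:
  assumes "M > 0" "D > 0" "squarefree D"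
  shows "tau (M\<^sup>2 * D) \<le> (\<Sum>r | r dvd M. 2 ^ omega (r * D))"
proof -
  define N where "N = M\<^sup>2 * D"
  have N: "N > 0" using assms by (simp add: N_def)
  define c where "c u = gcd u (N div u)" for u
  define f where "f u = (M div c u, {p. prime p \<and> p dvd u div c u})" for u
  define T where "T = (SIGMA r:{r. r dvd M}. Pow {p. prime p \<and> p dvd r * D})"
  \<comment> \<open>\<open>(c u)\<^sup>2\<close> divides \<open>N\<close>, so \<open>c u\<close>
    divides \<open>M\<close> because \<open>D\<close> is squarefree; cancelling that square leaves a
    coprime factorization.\<close>
  have key: "c u dvd M \<and> c u > 0 \<and> u = c u * (u div c u) \<and> coprime (u div c u) (N div u div c u)
      \<and> (u div c u) * (N div u div c u) = (M div c u)\<^sup>2 * D" if u: "u dvd N" for u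
  proof -
    have u0: "u > 0" using u N by (auto intro: Nat.gr0I)
    then have c0: "c u > 0" by (simp add: c_def)
    obtain a where a: "u = c u * a" by (metis c_def gcd_dvd1 dvdE)
    obtain b where b: "N div u = c u * b" by (metis c_def gcd_dvd2 dvdE)
    have ab: "u div c u = a" "N div u div c u = b" using a b c0 by (metis nonzero_mult_div_cancel_left less_irrefl)+
    have cop: "coprime a b" using u0 ab unfolding c_def
      by (metis div_gcd_coprime less_irrefl)
    have NN: "N = (c u)\<^sup>2 * (a * b)"
      using a b u by (metis dvd_mult_div_cancel mult.assoc mult.left_commute power2_eq_square)
    then have cM: "c u dvd M" using assms N_def by (metis dvd_of_square_dvd_squarefree dvd_triv_left)
    then obtain r where r: "M = c u * r" by blast
    then have "(c u)\<^sup>2 * (a * b) = (c u)\<^sup>2 * (r\<^sup>2 * D)"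
      using NN unfolding N_def r by (simp only: power_mult_distrib mult.assoc)
    then have "a * b = r\<^sup>2 * D" using c0 by (metis mult_left_cancel zero_less_power less_irrefl)
    moreover have "M div c u = r" using r c0 by (metis nonzero_mult_div_cancel_left less_irrefl)
    ultimately show ?thesis using a cM c0 cop ab by metis
  qed
  have "f ` {u. u dvd N} \<subseteq> T"
  proof (clarsimp simp: f_def T_def)
    fix u assume u: "u dvd N"
    have "c u dvd M" using key u by blast
    moreover have "p dvd M div c u * D" if "prime p" "p dvd u div c u" for p
    proof -
      have "p dvd (M div c u)\<^sup>2 * D" using that key[OF u] by (metis dvd_mult2)
      then show ?thesis using that(1) by (auto simp: prime_dvd_mult_iff dest: prime_dvd_power)
    qed
    ultimately show "M div c u dvd M \<and> {p. prime p \<and> p dvd u div c u} \<subseteq> {p. prime p \<and> p dvd M div c u * D}"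
      by (auto simp: div_dvd_iff_mult)
  qed
  moreover have "inj_on f {u. u dvd N}"
  proof
    fix u v assume u: "u \<in> {u. u dvd N}" and v: "v \<in> {u. u dvd N}" and eq: "f u = f v"
    note ku = key[of u] and kv = key[of v]
    have "M div (M div c x) = c x" if "c x dvd M" for x
      using that assms(1) by auto
    then have "M div (M div c u) = c u" "M div (M div c v) = c v"
      using ku kv u v by blast+
    moreover have "M div c u = M div c v" using eq by (simp add: f_def)
    ultimately have cc: "c u = c v" by metis
    have primes: "p dvd u div c u \<longleftrightarrow> p dvd v div c v" if "prime p" for p
      using eq that by (auto simp: f_def)
    \<comment> \<open>The cofactor of \<open>x\<close> divides the product of the two coprime
      factors belonging to \<open>y\<close>. The condition on primes makes it coprime to the second,
      hence it divides the first.\<close>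
    have dvd: "x div c x dvd y div c y"
      if "x dvd N" "y dvd N" "c x = c y"
        and "\<And>p. prime p \<Longrightarrow> p dvd x div c x \<Longrightarrow> p dvd y div c y" for x y
    proof -
      have "x div c x dvd (y div c y) * (N div y div c y)"
        using key[OF that(1)] key[OF that(2)] that(3) by (metis dvd_triv_left)
      moreover have "coprime (x div c x) (N div y div c y)"
      proof (rule ccontr)
        assume "\<not> coprime (x div c x) (N div y div c y)"
        then have "gcd (x div c x) (N div y div c y) \<noteq> 1" by (simp add: coprime_iff_gcd_eq_1)
        then obtain p where p: "prime p" "p dvd x div c x" "p dvd N div y div c y"
          using prime_factor_nat by (metis gcd_greatest_iff)
        then have "p dvd y div c y" using that(4) by blast
        then show False
          using p key[OF that(2)] coprime_common_divisor not_prime_unit by blast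
      qed
      ultimately show ?thesis by (simp add: coprime_dvd_mult_left_iff)
    qed
    have "u div c u = v div c v"
      using dvd[of u v] dvd[of v u] u v cc primes by (metis dvd_antisym mem_Collect_eq)
    then show "u = v" using ku kv u v cc by (metis mem_Collect_eq)
  qed
  moreover have fin: "finite {p. prime p \<and> p dvd r * D}" if "r dvd M" for r
  proof (rule finite_subset)
    show "finite {p. p dvd r * D}" using that assms by (auto intro!: finite_divisors_nat intro: Nat.gr0I)
  qed auto
  moreover have "finite T" using assms fin unfolding T_def by (intro finite_SigmaI) auto
  ultimately have "card {u. u dvd N} \<le> card T" by (metis card_inj_on_le)
  also have "card T = (\<Sum>r | r dvd M. card (Pow {p. prime p \<and> p dvd r * D}))"
    unfolding T_def using assms fin by (intro card_SigmaI) auto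
  also have "\<dots> = (\<Sum>r | r dvd M. 2 ^ omega (r * D))"
    by (intro sum.cong refl) (simp add: card_Pow fin omega_def)
  finally show ?thesis by (simp add: tau_def N_def)
qed

section \<open>Antichains of divisors\<close>

lemma tau_prime_power_mult:
  assumes "prime p" "\<not> p dvd n" "n > 0"
  shows "Suc e * tau n \<le> tau (p ^ e * n)"
proof -
  have p: "p > 0" using assms(1) prime_gt_0_nat by blast
  have "inj_on (\<lambda>(i, d). p ^ i * d) ({..e} \<times> {d. d dvd n})"
  proof (rule inj_onI, clarify)
    fix i d j d' assume d: "d dvd n" "d' dvd n" and eq: "p ^ i * d = p ^ j * d'"
    have nd: "\<not> p dvd d" "\<not> p dvd d'" using d assms(2) dvd_trans by blast+
    have "multiplicity p (p ^ i * d) = i" "multiplicity p (p ^ j * d') = j"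
      using nd assms(1) by (auto intro!: multiplicity_eqI)
    then have "i = j" using eq by simp
    then show "i = j \<and> d = d'" using eq p by simp
  qed
  moreover have "(\<lambda>(i, d). p ^ i * d) ` ({..e} \<times> {d. d dvd n}) \<subseteq> {d. d dvd p ^ e * n}"
    by (auto intro: mult_dvd_mono le_imp_power_dvd)
  moreover have "finite {d. d dvd p ^ e * n}" using assms(3) p by simp
  ultimately have "card ({..e} \<times> {d. d dvd n}) \<le> tau (p ^ e * n)"
    unfolding tau_def by (metis card_inj_on_le)
  then show ?thesis by (simp add: card_cartesian_product tau_def)
qed

text \<open>This is the sum of \<open>k choose j\<close> over all \<open>j\<close> with
  \<open>2 * j \<le> x\<close>; the recursion is Pascal's rule. Doubling \<open>j\<close> avoids
  halves, and an integer cutoff may be negative.\<close>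

fun binomial_tail :: "nat \<Rightarrow> int \<Rightarrow> real" where
  "binomial_tail 0 x = (if x \<ge> 0 then 1 else 0)"
| "binomial_tail (Suc k) x = binomial_tail k x + binomial_tail k (x - 2)"

text \<open>The number of chains in the symmetric chain decomposition of the product of an \<open>l\<close>-element
  chain with a Boolean lattice of rank \<open>k\<close>: the sum of the \<open>l\<close> middle binomial coefficients of \<open>k\<close>.\<close>

definition chain_weight :: "nat \<Rightarrow> nat \<Rightarrow> real" where
  "chain_weight k l = binomial_tail k (int k + int l) - binomial_tail k (int k - int l)"

lemma chain_weight_zero_right [simp]: "chain_weight k 0 = 0"
  by (simp add: chain_weight_def)

lemma chain_weight_zero_left: "chain_weight 0 l = (if l = 0 then 0 else 1)"
  by (simp add: chain_weight_def)

text \<open>The numerical shadow of a chain product: an \<open>l\<close>-element chain times a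
  2-element chain splits into chains of \<open>l + 1\<close> and \<open>l - 1\<close>
  elements.\<close>

lemma chain_weight_Suc:
  "l > 0 \<Longrightarrow> chain_weight (Suc k) l = chain_weight k (Suc l) + chain_weight k (l - 1)"
  by (simp add: chain_weight_def of_nat_diff algebra_simps)

text \<open>Raising the cutoff by 2 admits exactly one more index, \<open>x div 2\<close>. Negative
  \<open>x\<close> is separated because \<open>nat\<close> would send it to 0, giving a coefficient
  1.\<close>

lemma binomial_tail_diff:
  "binomial_tail k x - binomial_tail k (x - 2) = (if x < 0 then 0 else real (k choose nat (x div 2)))"
proof (induction k arbitrary: x)
  case 0
  show ?case
  proof (cases "x < 0 \<or> x \<ge> 2")
    case True
    then show ?thesis by (auto simp: binomial_eq_0)
  next
    case False
    then have "x = 0 \<or> x = 1" by auto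
    then show ?thesis by auto
  qed
next
  case (Suc k)
  have "binomial_tail (Suc k) x - binomial_tail (Suc k) (x - 2)
     = (binomial_tail k x - binomial_tail k (x - 2)) + (binomial_tail k (x - 2) - binomial_tail k (x - 2 - 2))"
    by simp
  also have "\<dots> = (if x < 0 then 0 else real (k choose nat (x div 2))) +
       (if x - 2 < 0 then 0 else real (k choose nat ((x - 2) div 2)))"
    by (simp only: Suc.IH)
  also have "\<dots> = (if x < 0 then 0 else real (Suc k choose nat (x div 2)))"
  proof (cases "x < 2")
    case True
    then have "x < 0 \<or> x div 2 = 0" by auto
    then show ?thesis using True by auto
  next
    case False
    then have "nat (x div 2) = Suc (nat ((x - 2) div 2))" by auto
    then show ?thesis using False by simp
  qed
  finally show ?case .
qed

section \<open>Size of the middle binomial coefficients\<close>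

lemma chain_weight_one: "chain_weight k 1 = real (k choose (Suc k div 2))"
proof -
  have "nat ((1 + int k) div 2) = Suc k div 2" by linarith
  then show ?thesis
    using binomial_tail_diff[of k "int k + 1"] by (simp add: chain_weight_def algebra_simps)
qed

text \<open>Squaring keeps the induction in the naturals. With the denominator cleared by
  \<open>(Suc m)\<^sup>2\<close>, the step comes down to
  \<open>(2 * m + 1) * (2 * m + 3) \<le> 4 * (Suc m)\<^sup>2\<close>.\<close>

lemma central_binomial_square_le: "(2 * m choose m)\<^sup>2 * (2 * m + 1) \<le> 16 ^ m"
proof (induction m)
  case (Suc m)
  let ?c = "2 * m choose m" and ?d = "2 * Suc m choose Suc m"
  have eq: "Suc m * ?d = 2 * (2 * m + 1) * ?c"
  proof -
    have "Suc m * ?d = (2 * Suc m) * (Suc (2 * m) choose m)"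
      using Suc_times_binomial_eq[of "Suc (2 * m)" m] by (simp add: mult.commute)
    moreover have "Suc m * (Suc (2 * m) choose m) = (2 * m + 1) * ?c"
      using Suc_times_binomial_add[of m m] Suc_times_binomial_eq[of "2*m" m] binomial_symmetric[of m "Suc (2 * m)"]
      by (simp add: mult_2 algebra_simps)
    ultimately show ?thesis by (metis mult.assoc mult.commute mult_Suc_right mult.left_commute mult_left_cancel nat.distinct(1))
  qed
  have "(Suc m)\<^sup>2 * (d\<^sup>2 * (2 * Suc m + 1)) = (Suc m * d)\<^sup>2 * (2 * m + 3)" for d
    unfolding power_mult_distrib by (simp add: algebra_simps)
  then have "(Suc m)\<^sup>2 * (?d\<^sup>2 * (2 * Suc m + 1)) = (Suc m * ?d)\<^sup>2 * (2 * m + 3)" .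
  also have "\<dots> = (?c\<^sup>2 * (2 * m + 1)) * (4 * (2 * m + 1) * (2 * m + 3))"
    unfolding eq by (simp add: power_mult_distrib power2_eq_square algebra_simps)
  also have "\<dots> \<le> 16 ^ m * (16 * (Suc m)\<^sup>2)"
    by (rule mult_mono[OF Suc.IH]) (simp_all add: power2_eq_square algebra_simps)
  finally have "(Suc m)\<^sup>2 * (?d\<^sup>2 * (2 * Suc m + 1)) \<le> (Suc m)\<^sup>2 * 16 ^ Suc m" by (simp add: algebra_simps)
  then show ?case by simp
qed auto

lemma central_binomial_le: "real (2 * m choose m) \<le> 4 ^ m / sqrt (2 * real m + 1)"
proof -
  have "(real (2 * m choose m) * sqrt (2 * real m + 1))\<^sup>2 = real ((2 * m choose m)\<^sup>2 * (2 * m + 1))"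
    by (simp add: power_mult_distrib distrib_left)
  also have "\<dots> \<le> real (16 ^ m)" using central_binomial_square_le of_nat_le_iff by blast
  also have "\<dots> = (4 ^ m)\<^sup>2" by (simp add: power2_eq_square power_mult_distrib[symmetric])
  finally have "real (2 * m choose m) * sqrt (2 * real m + 1) \<le> 4 ^ m"
    by (rule power2_le_imp_le) simp
  then show ?thesis by (simp add: field_simps)
qed

text \<open>For odd \<open>k\<close> the middle coefficient is half the central one of rank
  \<open>k + 1\<close>, so both parities reduce to \<open>central_binomial_le\<close>.\<close>

lemma chain_weight_one_le: "chain_weight k 1 \<le> 2 ^ k / sqrt (real k + 1)"
proof (cases "even k")
  case True
  then obtain m where k: "k = 2 * m" by blast
  then show ?thesis using central_binomial_le[of m]
    by (simp add: chain_weight_one[unfolded One_nat_def] power_mult)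
next
  case False
  then obtain m where k: "k = 2 * m + 1" using oddE by blast
  have "Suc (2 * m) choose Suc m = Suc (2 * m) choose m"
    using binomial_symmetric[of "Suc m" "Suc (2 * m)"] by simp
  then have "2 * (k choose Suc m) = (2 * Suc m choose Suc m)"
    by (simp add: k)
  then have "2 * real (k choose Suc m) = real (2 * Suc m choose Suc m)"
    by (metis of_nat_mult of_nat_numeral)
  also have "\<dots> \<le> 4 ^ Suc m / sqrt (2 * real (Suc m) + 1)" by (rule central_binomial_le)
  also have "\<dots> \<le> 4 ^ Suc m / sqrt (real k + 1)"
    by (intro divide_left_mono) (auto simp: k)
  finally show ?thesis by (simp add: chain_weight_one[unfolded One_nat_def] k power_mult)
qed

text \<open>Convexity of the square replaces the square roots by reciprocals, leaving
  \<open>(x + 1 / 3)\<^sup>2 \<le> x * (x + 1)\<close>. The weight 2/3 is the least share of the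
  exponents of a prime that gets paired; the shift 1/3 is the gain per prime.\<close>

lemma inverse_sqrt_average:
  fixes x :: real
  assumes "x \<ge> 1"
  shows "(2 / 3) / sqrt (x + 1) + (1 / 3) / sqrt x \<le> 1 / sqrt (x + 1 / 3)"
proof (rule power2_le_imp_le)
  define a b where "a = 1 / sqrt (x + 1)" and "b = 1 / sqrt x"
  have a: "a\<^sup>2 = 1 / (x + 1)" and b: "b\<^sup>2 = 1 / x"
    using assms by (auto simp: a_def b_def power_divide)
  have "0 \<le> (a - b)\<^sup>2" by simp
  then have "(2 / 3 * a + 1 / 3 * b)\<^sup>2 \<le> 2 / 3 * a\<^sup>2 + 1 / 3 * b\<^sup>2"
    by (simp add: power2_eq_square algebra_simps)
  also have "\<dots> \<le> 1 / (x + 1 / 3)"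
    using assms unfolding a b by (simp add: divide_simps) (simp add: algebra_simps)
  also have "\<dots> = (1 / sqrt (x + 1 / 3))\<^sup>2" using assms by (simp add: power_divide)
  finally show "((2 / 3) / sqrt (x + 1) + (1 / 3) / sqrt x)\<^sup>2 \<le> (1 / sqrt (x + 1 / 3))\<^sup>2"
    by (simp add: a_def b_def)
qed (use assms in simp)

text \<open>The left side decreases in \<open>t\<close>, so \<open>t = 2 / 3\<close> is the worst
  case.\<close>

lemma inverse_sqrt_weighted_average:
  fixes x t :: real
  assumes "x \<ge> 1" "2 / 3 \<le> t" "t \<le> 1"
  shows "t / sqrt (x + 1) + (1 - t) / sqrt x \<le> 1 / sqrt (x + 1 / 3)"
proof -
  have "1 / sqrt (x + 1) \<le> 1 / sqrt x" using assms by (intro divide_left_mono) auto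
  then have "(t - 2 / 3) * (1 / sqrt (x + 1)) \<le> (t - 2 / 3) * (1 / sqrt x)"
    using assms by (intro mult_left_mono) auto
  then show ?thesis using inverse_sqrt_average[OF assms(1)] by (simp add: algebra_simps diff_divide_distrib)
qed

section \<open>Chains for divisibility and their products with prime powers\<close>

definition dvd_chain :: "nat set \<Rightarrow> bool" where
  "dvd_chain c \<longleftrightarrow> finite c \<and> 0 \<notin> c \<and> (\<forall>x\<in>c. \<forall>y\<in>c. x dvd y \<or> y dvd x)"

text \<open>Taken as a set, the top is a singleton for a nonempty chain and empty for the empty one,
  so \<open>chain_pair\<close> needs no case distinction.\<close>

definition chain_top :: "nat set \<Rightarrow> nat set" where
  "chain_top c = {t \<in> c. \<forall>y\<in>c. y dvd t}"

text \<open>The chains may overlap or be empty; only the sum of their weights over the list matters,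
  and an empty chain has weight 0.\<close>

definition chain_cover :: "nat \<Rightarrow> nat set list \<Rightarrow> bool" where
  "chain_cover n cs \<longleftrightarrow> (\<forall>c\<in>set cs. dvd_chain c \<and> (\<forall>x\<in>c. x dvd n)) \<and> (\<forall>d. d dvd n \<longrightarrow> (\<exists>c\<in>set cs. d \<in> c))"

lemma card_chain_top:
  assumes "dvd_chain c" "c \<noteq> {}"
  shows "card (chain_top c) = 1"
proof -
  have fin: "finite c" "0 \<notin> c" and ch: "\<And>x y. x \<in> c \<Longrightarrow> y \<in> c \<Longrightarrow> x dvd y \<or> y dvd x"
    using assms(1) by (auto simp: dvd_chain_def)
  have "Max c \<in> c" using fin assms by simp
  moreover have "y dvd Max c" if "y \<in> c" for y
    using ch[OF that \<open>Max c \<in> c\<close>] that fin Max_ge[OF fin(1) that] dvd_imp_le[of "Max c" y]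
    by (metis dvd_refl le_antisym not_gr_zero)
  ultimately have "chain_top c = {Max c}"
    unfolding chain_top_def by (auto intro: dvd_antisym)
  then show ?thesis by simp
qed

text \<open>The symmetric chain step for \<open>c\<close> times the two levels \<open>p ^ i\<close>
  and \<open>p ^ Suc i\<close>: one chain climbs the lower level and steps up at the top, the other
  consists of what remains on the upper level.\<close>

definition chain_pair :: "nat \<Rightarrow> nat set \<Rightarrow> nat \<Rightarrow> nat set list" where
  "chain_pair p c i =
     [(*) (p ^ i) ` c \<union> (*) (p ^ Suc i) ` chain_top c, (*) (p ^ Suc i) ` (c - chain_top c)]"

text \<open>The exponents from 0 to \<open>e\<close> are grouped into consecutive pairs. For even
  \<open>e\<close> the exponent 0 stays single and the pairs start at 1, which is
  \<open>Suc e mod 2\<close>.\<close>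

definition chain_times_power :: "nat \<Rightarrow> nat \<Rightarrow> nat set \<Rightarrow> nat set list" where
  "chain_times_power p e c = (if even e then [c] else []) @
     concat (map (\<lambda>s. chain_pair p c (Suc e mod 2 + 2 * s)) [0..<Suc e div 2])"

lemma dvd_chain_pair:
  assumes "dvd_chain c" "p > 0" "c' \<in> set (chain_pair p c i)"
  shows "dvd_chain c'"
proof -
  have fin: "finite c" "0 \<notin> c" and ch: "\<And>x y. x \<in> c \<Longrightarrow> y \<in> c \<Longrightarrow> x dvd y \<or> y dvd x"
    using assms(1) by (auto simp: dvd_chain_def)
  have top: "finite (chain_top c)" "chain_top c \<subseteq> c" using fin by (auto simp: chain_top_def)
  have eq: "x = y" if "x \<in> chain_top c" "y \<in> chain_top c" for x y
    using that by (auto simp: chain_top_def intro: dvd_antisym)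
  \<comment> \<open>On the upper level only the top of \<open>c\<close> occurs in the first chain,
    and every element of \<open>c\<close> divides it.\<close>
  have up: "p ^ i * x dvd p ^ Suc i * y" if "x \<in> c" "y \<in> chain_top c" for x y
    using that by (auto simp: chain_top_def intro!: mult_dvd_mono)
  consider "c' = (*) (p ^ i) ` c \<union> (*) (p ^ Suc i) ` chain_top c"
    | "c' = (*) (p ^ Suc i) ` (c - chain_top c)"
    using assms(3) by (auto simp: chain_pair_def)
  then show ?thesis
  proof cases
    case 1
    show ?thesis unfolding 1 dvd_chain_def
    proof (intro conjI ballI)
      show "finite ((*) (p ^ i) ` c \<union> (*) (p ^ Suc i) ` chain_top c)" using fin top by simp
      show "0 \<notin> (*) (p ^ i) ` c \<union> (*) (p ^ Suc i) ` chain_top c" using fin top assms(2) by auto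
    next
      have same: "m * a dvd m * b \<or> m * b dvd m * a" if "a \<in> c" "b \<in> c" for a b m :: nat
        using ch[OF that] by (auto intro: mult_dvd_mono)
      fix x y
      assume "x \<in> (*) (p ^ i) ` c \<union> (*) (p ^ Suc i) ` chain_top c"
        "y \<in> (*) (p ^ i) ` c \<union> (*) (p ^ Suc i) ` chain_top c"
      then show "x dvd y \<or> y dvd x"
        using top(2) by (elim UnE imageE) (simp_all only: same up subset_iff, simp_all)
    qed
  next
    case 2
    then show ?thesis using fin ch assms(2) by (auto simp: dvd_chain_def mult_dvd_mono)
  qed
qed

lemma dvd_chain_times_power:
  assumes "dvd_chain c" "p > 0" "c' \<in> set (chain_times_power p e c)"
  shows "dvd_chain c'"
  using assms dvd_chain_pair[OF assms(1,2)]
  by (auto simp: chain_times_power_def split: if_splits)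

lemma chain_pair_covers:
  assumes "x \<in> c" "j = i \<or> j = Suc i"
  shows "\<exists>c'\<in>set (chain_pair p c i). p ^ j * x \<in> c'"
  using assms by (cases "x \<in> chain_top c") (auto simp: chain_pair_def)

lemma chain_times_power_covers:
  assumes "x \<in> c" "i \<le> e"
  shows "\<exists>c'\<in>set (chain_times_power p e c). p ^ i * x \<in> c'"
proof (cases "even e \<and> i = 0")
  case True
  then show ?thesis using assms by (simp add: chain_times_power_def)
next
  case False
  \<comment> \<open>\<open>r\<close> is the first paired exponent and \<open>s\<close> the index of
    the pair that contains \<open>i\<close>.\<close>
  define r where "r = Suc e mod 2"
  define s where "s = (i - r) div 2"
  have r: "r \<le> i" "r = 0 \<or> r = 1"
    using False by (auto simp: r_def mod_2_eq_odd)
  then have i: "i = r + 2 * s \<or> i = Suc (r + 2 * s)" by (auto simp: s_def)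
  have "Suc e = r + 2 * (Suc e div 2)" by (simp add: r_def)
  then have "s < Suc e div 2" using assms(2) i by linarith
  moreover obtain c' where "c' \<in> set (chain_pair p c (r + 2 * s))" "p ^ i * x \<in> c'"
    using chain_pair_covers[OF assms(1) i] by blast
  ultimately show ?thesis by (auto simp: chain_times_power_def r_def)
qed

lemma chain_times_power_dvd:
  assumes "\<forall>x\<in>c. x dvd n" "c' \<in> set (chain_times_power p e c)" "x \<in> c'"
  shows "x dvd p ^ e * n"
proof -
  have *: "p ^ i * y dvd p ^ e * n" if "i \<le> e" "y \<in> c" for i y
    using that assms(1) by (auto intro: mult_dvd_mono le_imp_power_dvd)
  have "chain_top c \<subseteq> c" by (auto simp: chain_top_def)
  consider "c' = c" | s where "s < Suc e div 2" "c' \<in> set (chain_pair p c (Suc e mod 2 + 2 * s))"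
    using assms(2) by (auto simp: chain_times_power_def split: if_splits)
  then show ?thesis
  proof cases
    case 1
    then show ?thesis using *[of 0] assms(3) by simp
  next
    case 2
    define i where "i = Suc e mod 2 + 2 * s"
    \<comment> \<open>Hence the last pair ends exactly at the exponent \<open>e\<close>.\<close>
    have "Suc e = Suc e mod 2 + 2 * (Suc e div 2)" by simp
    then have "Suc i \<le> e" using 2(1) unfolding i_def by linarith
    moreover obtain y j where "j = i \<or> j = Suc i" "y \<in> c" "x = p ^ j * y"
      using 2(2) assms(3) \<open>chain_top c \<subseteq> c\<close> unfolding i_def[symmetric] chain_pair_def
      by (auto simp del: power_Suc)
    ultimately show ?thesis using * by (metis Suc_leD)
  qed
qed

lemma chain_cover_times_power:
  assumes "prime p" "chain_cover n cs"
  shows "chain_cover (p ^ e * n) (concat (map (chain_times_power p e) cs))"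
  unfolding chain_cover_def
proof (intro conjI allI impI ballI)
  have p: "p > 0" using assms(1) prime_gt_0_nat by blast
  fix c' assume "c' \<in> set (concat (map (chain_times_power p e) cs))"
  then obtain c where c: "c \<in> set cs" "c' \<in> set (chain_times_power p e c)" by auto
  then show "dvd_chain c'"
    using dvd_chain_times_power[OF _ p] assms(2) by (auto simp: chain_cover_def)
  fix x assume "x \<in> c'"
  then show "x dvd p ^ e * n"
    using chain_times_power_dvd[of c n c' p e x] c assms(2) by (auto simp: chain_cover_def)
next
  fix d assume "d dvd p ^ e * n"
  then obtain a x where d: "d = a * x" "a dvd p ^ e" "x dvd n"
    using division_decomp by blast
  then obtain i where i: "i \<le> e" "a = p ^ i" using assms(1) divides_primepow_nat by blast
  obtain c where c: "c \<in> set cs" "x \<in> c" using assms(2) d(3) by (auto simp: chain_cover_def)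
  show "\<exists>c'\<in>set (concat (map (chain_times_power p e) cs)). d \<in> c'"
    using chain_times_power_covers[OF c(2) i(1), of p] c(1) d(1) i(2) by auto
qed

text \<open>The two levels are disjoint because \<open>p\<close> divides no element of
  \<open>c\<close>. The chains thus have one element more and one fewer than \<open>c\<close>, and
  \<open>chain_weight_Suc\<close> applies; the empty chain is treated apart.\<close>

lemma chain_pair_weight:
  assumes "dvd_chain c" "prime p" "\<forall>x\<in>c. \<not> p dvd x"
  shows "(\<Sum>c'\<leftarrow>chain_pair p c i. chain_weight k (card c')) = chain_weight (Suc k) (card c)"
proof (cases "c = {}")
  case True
  then show ?thesis by (simp add: chain_pair_def chain_top_def)
next
  case False
  have p: "p > 0" using assms(2) prime_gt_0_nat by blast
  have fin: "finite c" using assms(1) by (simp add: dvd_chain_def)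
  have top: "card (chain_top c) = 1" "chain_top c \<subseteq> c"
    using card_chain_top[OF assms(1) False] by (auto simp: chain_top_def)
  have inj: "inj_on ((*) (p ^ j)) A" for j A using p by (auto simp: inj_on_def)
  have "(*) (p ^ i) ` c \<inter> (*) (p ^ Suc i) ` chain_top c = {}"
  proof -
    have "p ^ i * x \<noteq> p ^ Suc i * y" if "x \<in> c" for x y
      using that assms(3) p by (auto simp: mult.assoc mult.left_commute)
    then show ?thesis by blast
  qed
  then have "card ((*) (p ^ i) ` c \<union> (*) (p ^ Suc i) ` chain_top c) = Suc (card c)"
    using fin top inj by (subst card_Un_disjoint) (auto simp: card_image dest: finite_subset simp del: power_Suc)
  moreover have "card ((*) (p ^ Suc i) ` (c - chain_top c)) = card c - 1"
    using fin top inj by (simp add: card_image card_Diff_subset finite_subset del: power_Suc)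
  moreover have "card c > 0" using fin False by (simp add: card_gt_0_iff)
  ultimately show ?thesis by (simp add: chain_pair_def chain_weight_Suc del: power_Suc)
qed

lemma chain_times_power_weight:
  assumes "dvd_chain c" "prime p" "\<forall>x\<in>c. \<not> p dvd x"
  shows "(\<Sum>c'\<leftarrow>chain_times_power p e c. chain_weight k (card c'))
    = real (Suc e mod 2) * chain_weight k (card c) + real (Suc e div 2) * chain_weight (Suc k) (card c)"
proof -
  have "(\<Sum>c'\<leftarrow>concat (map (\<lambda>s. chain_pair p c (f s)) xs). chain_weight k (card c'))
      = real (length xs) * chain_weight (Suc k) (card c)" for f and xs :: "nat list"
    by (induction xs) (simp_all add: chain_pair_weight[OF assms] algebra_simps del: One_nat_def)
  then show ?thesis by (simp add: chain_times_power_def mod_2_eq_odd)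
qed

lemma concat_chain_weight:
  assumes "\<forall>c\<in>set cs. dvd_chain c \<and> (\<forall>x\<in>c. \<not> p dvd x)" "prime p"
  shows "(\<Sum>c'\<leftarrow>concat (map (chain_times_power p e) cs). chain_weight k (card c'))
    = real (Suc e mod 2) * (\<Sum>c\<leftarrow>cs. chain_weight k (card c))
      + real (Suc e div 2) * (\<Sum>c\<leftarrow>cs. chain_weight (Suc k) (card c))"
  using assms(1)
  by (induction cs) (simp_all add: chain_times_power_weight[OF _ assms(2)] algebra_simps)

text \<open>The bound is required for all \<open>k\<close> simultaneously: multiplying by a prime power replaces
  the weight of rank \<open>k\<close> by a combination of the weights of ranks \<open>k\<close> and \<open>k + 1\<close>.\<close>

lemma small_chain_cover:
  assumes "n > 0"
  shows "\<exists>cs. chain_cover n cs \<and> (\<forall>k. (\<Sum>c\<leftarrow>cs. chain_weight k (card c))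
           \<le> real (tau n) * 2 ^ k / sqrt (real k + 1 + real (omega n) / 3))"
  using assms
proof (induction n rule: less_induct)
  case (less n)
  show ?case
  proof (cases "n = 1")
    case True
    \<comment> \<open>The base case is the bound on a single middle binomial coefficient, for every
      rank \<open>k\<close>.\<close>
    have "chain_cover 1 [{1}]" by (simp add: chain_cover_def dvd_chain_def)
    moreover have "{p::nat. prime p \<and> p dvd 1} = {}" by auto
    then have "omega 1 = 0" "tau 1 = 1" by (simp_all only: omega_def tau_def) simp_all
    ultimately show ?thesis using True chain_weight_one_le
      by (intro exI[of _ "[{1}]"]) simp
  next
    case False
    then obtain p where p: "prime p" "p dvd n" using prime_factor_nat by blast
    then have p1: "p > 1" using prime_gt_1_nat by blast
    define e where "e = multiplicity p n"
    obtain n' where n': "n = p ^ e * n'" "\<not> p dvd n'"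
      using multiplicity_decompose'[of n p] less.prems p1 unfolding e_def by auto
    have e: "e > 0" using p n' by (metis not_gr_zero power_0 mult_1)
    have n'0: "n' > 0" using less.prems n' by (simp add: Nat.gr0I)
    have "1 < p ^ e" using p1 e by (rule one_less_power)
    then have "n' < n" using n' n'0 by simp
    then obtain cs where cs: "chain_cover n' cs"
      and le: "\<And>k. (\<Sum>c\<leftarrow>cs. chain_weight k (card c))
           \<le> real (tau n') * 2 ^ k / sqrt (real k + 1 + real (omega n') / 3)"
      using less.IH n'0 by blast
    define cs' where "cs' = concat (map (chain_times_power p e) cs)"
    have "chain_cover n cs'"
      using chain_cover_times_power[OF p(1) cs] by (simp add: cs'_def n')
    moreover have "(\<Sum>c\<leftarrow>cs'. chain_weight k (card c))
        \<le> real (tau n) * 2 ^ k / sqrt (real k + 1 + real (omega n) / 3)" for k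
    proof -
      define x where "x = real k + 1 + real (omega n') / 3"
      define r d where "r = real (Suc e mod 2)" and "d = real (Suc e div 2)"
      define T where "T = real (tau n') * 2 ^ k"
      \<comment> \<open>The share of the \<open>Suc e\<close> exponents that lie in pairs.\<close>
      define t where "t = 2 * d / real (Suc e)"
      have red: "r + 2 * d = real (Suc e)" unfolding r_def d_def
        by (metis mod_mult_div_eq of_nat_add of_nat_mult of_nat_numeral)
      \<comment> \<open>An exponent is left single only for even \<open>e\<close>; then
        \<open>e \<ge> 2\<close>, so it is at most one of three.\<close>
      have r: "r \<ge> 0" "r \<le> real (Suc e) / 3" 
      proof -
        show "r \<ge> 0" by (simp add: r_def)
        show "r \<le> real (Suc e) / 3"
          using e by (cases "even e") (auto simp: r_def mod_2_eq_odd elim!: evenE)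
      qed
      have t: "2 / 3 \<le> t" "t \<le> 1" "1 - t = r / real (Suc e)"
        using red r by (auto simp: t_def field_simps)
      have x: "x \<ge> 1" by (simp add: x_def)
      have "\<forall>c\<in>set cs. dvd_chain c \<and> (\<forall>x\<in>c. \<not> p dvd x)"
        using cs n'(2) unfolding chain_cover_def by (meson dvd_trans)
      then have "(\<Sum>c\<leftarrow>cs'. chain_weight k (card c)) =
          r * (\<Sum>c\<leftarrow>cs. chain_weight k (card c)) + d * (\<Sum>c\<leftarrow>cs. chain_weight (Suc k) (card c))"
        unfolding cs'_def r_def d_def using concat_chain_weight p(1) by blast
      also have "\<dots> \<le> r * (T / sqrt x) + d * (2 * T / sqrt (x + 1))"
        using le[of k] le[of "Suc k"] r(1)
        by (intro add_mono mult_left_mono) (auto simp: x_def T_def d_def algebra_simps)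
      also have "\<dots> = real (Suc e) * T * (t / sqrt (x + 1) + (1 - t) / sqrt x)"
      proof -
        have "r = real (Suc e) * (1 - t)" "2 * d = real (Suc e) * t"
          using t(3) by (simp_all add: t_def)
        then have "r * (T / sqrt x) + d * (2 * T / sqrt (x + 1))
            = real (Suc e) * (1 - t) * T / sqrt x + real (Suc e) * t * T / sqrt (x + 1)"
          by (metis (no_types, lifting) mult.assoc mult.commute times_divide_eq_right)
        then show ?thesis by (simp add: algebra_simps diff_divide_distrib del: of_nat_Suc)
      qed
      also have "\<dots> \<le> real (Suc e) * T * (1 / sqrt (x + 1 / 3))"
        using x t by (intro mult_left_mono inverse_sqrt_weighted_average) (auto simp: T_def)
      also have "\<dots> \<le> real (tau n) * 2 ^ k * (1 / sqrt (x + 1 / 3))"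
      proof (intro mult_right_mono)
        have "real (Suc e * tau n') \<le> real (tau n)"
          using tau_prime_power_mult[OF p(1) n'(2) n'0, of e] n'(1) by (simp only: of_nat_le_iff)
        then show "real (Suc e) * T \<le> real (tau n) * 2 ^ k" unfolding T_def of_nat_mult mult.assoc[symmetric] by (rule mult_right_mono) simp
      qed (use x in simp)
      \<comment> \<open>The prime \<open>p\<close> raises \<open>omega\<close> by one, which is
        exactly the shift gained from the averaging inequality.\<close>
      also have "x + 1 / 3 = real k + 1 + real (omega n) / 3"
        using omega_prime_power_mult[OF p(1) n'(2) n'0 e] n'(1) by (simp add: x_def field_simps)
      finally show ?thesis by simp
    qed
    ultimately show ?thesis by blast
  qed
qed

text \<open>An antichain meets each chain in at most one element, and the rank 0 weights count the
  nonempty chains.\<close>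

lemma card_antichain_le_chain_cover:
  assumes "chain_cover n cs" "\<forall>x\<in>A. x dvd n" "\<forall>x\<in>A. \<forall>y\<in>A. x dvd y \<longrightarrow> x = y"
  shows "real (card A) \<le> (\<Sum>c\<leftarrow>cs. chain_weight 0 (card c))"
proof -
  have "real (card (A \<inter> \<Union>(set cs))) \<le> (\<Sum>c\<leftarrow>cs. chain_weight 0 (card c))"
    if "\<forall>c\<in>set cs. dvd_chain c" for cs
    using that
  proof (induction cs)
    case (Cons c cs)
    have fin: "finite c" using Cons.prems by (simp add: dvd_chain_def)
    have "x = y" if "x \<in> A \<inter> c" "y \<in> A \<inter> c" for x y
    proof -
      have "x dvd y \<or> y dvd x" using that Cons.prems by (auto simp: dvd_chain_def)
      then show ?thesis using that assms(3) by blast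
    qed
    then have "card (A \<inter> c) \<le> 1" using fin by (simp add: card_le_Suc0_iff_eq)
    moreover have "c = {} \<Longrightarrow> card (A \<inter> c) = 0" by simp
    ultimately have "real (card (A \<inter> c)) \<le> chain_weight 0 (card c)"
      using fin by (auto simp: chain_weight_zero_left)
    moreover have "A \<inter> \<Union>(set (c # cs)) = (A \<inter> c) \<union> (A \<inter> \<Union>(set cs))" by auto
    then have "real (card (A \<inter> \<Union>(set (c # cs)))) \<le> real (card (A \<inter> c)) + real (card (A \<inter> \<Union>(set cs)))"
      by (metis card_Un_le of_nat_add of_nat_le_iff)
    ultimately show ?case using Cons by simp
  qed simp
  moreover have "A \<inter> \<Union>(set cs) = A" using assms(1,2) by (fastforce simp: chain_cover_def)
  ultimately show ?thesis using assms(1) by (metis chain_cover_def)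
qed

lemma divisor_antichain_le:
  assumes "n > 0" "\<forall>x\<in>A. x dvd n" "\<forall>x\<in>A. \<forall>y\<in>A. x dvd y \<longrightarrow> x = y"
  shows "real (card A) \<le> real (tau n) / sqrt (1 + real (omega n) / 3)"
proof -
  obtain cs where cs: "chain_cover n cs"
    and le: "\<And>k. (\<Sum>c\<leftarrow>cs. chain_weight k (card c))
           \<le> real (tau n) * 2 ^ k / sqrt (real k + 1 + real (omega n) / 3)"
    using small_chain_cover[OF assms(1)] by blast
  show ?thesis using card_antichain_le_chain_cover[OF cs assms(2,3)] le[of 0] by simp
qed

section \<open>Reduced bases\<close>

lemma lattice_of_columns:
  "lattice_of A = {of_int s *\<^sub>R column 1 A + of_int t *\<^sub>R column 2 A | s t. True}"
proof -
  have *: "A *v z = z $ 1 *\<^sub>R column 1 A + z $ 2 *\<^sub>R column 2 A" for z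
    by (simp add: matrix_mult_sum sum_2 scalar_mult_eq_scaleR)
  show ?thesis
  proof (intro set_eqI iffI)
    fix x assume "x \<in> lattice_of A"
    then obtain z :: "real^2" where z: "x = A *v z" "\<forall>i. z $ i \<in> \<int>" by (auto simp: lattice_of_def)
    then obtain s t where "z $ 1 = of_int s" "z $ 2 = of_int t" by (meson Ints_cases)
    then show "x \<in> {of_int s *\<^sub>R column 1 A + of_int t *\<^sub>R column 2 A | s t. True}"
      using z(1) * by auto
  next
    fix x assume "x \<in> {of_int s *\<^sub>R column 1 A + of_int t *\<^sub>R column 2 A | s t. True}"
    then obtain s t where x: "x = of_int s *\<^sub>R column 1 A + of_int t *\<^sub>R column 2 A" by blast
    define z :: "real^2" where "z = vector [of_int s, of_int t]"
    have "z $ 1 = of_int s" "z $ 2 = of_int t" by (simp_all add: z_def)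
    then have "x = A *v z" "\<forall>i. z $ i \<in> \<int>" using x * by (auto simp: forall_2)
    then show "x \<in> lattice_of A" by (auto simp: lattice_of_def)
  qed
qed

lemma gram_entry: "(transpose A ** A) $ i $ j = column i A \<bullet> column j (A :: real^2^2)"
  by (simp add: matrix_matrix_mult_def transpose_def inner_vec_def column_def)

lemma det_columns:
  "det (A :: real^2^2) = column 1 A $ 1 * column 2 A $ 2 - column 2 A $ 1 * column 1 A $ 2"
  by (simp add: det_2 column_def)

lemma det_square_gram:
  "(det (A :: real^2^2))\<^sup>2 = (column 1 A \<bullet> column 1 A) * (column 2 A \<bullet> column 2 A) - (column 1 A \<bullet> column 2 A)\<^sup>2"
  by (simp add: det_columns inner_vec_def sum_2 power2_eq_square algebra_simps)

lemma column_in_lattice: "column 1 A \<in> lattice_of A" "column 2 A \<in> lattice_of A"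
proof -
  have "column 1 A = of_int 1 *\<^sub>R column 1 A + of_int 0 *\<^sub>R column 2 A"
    "column 2 A = of_int 0 *\<^sub>R column 1 A + of_int 1 *\<^sub>R column 2 A" by simp_all
  then show "column 1 A \<in> lattice_of A" "column 2 A \<in> lattice_of A"
    unfolding lattice_of_columns by blast+
qed

lemma lattice_of_closed:
  assumes "x \<in> lattice_of A" "y \<in> lattice_of A"
  shows "of_int s *\<^sub>R x + of_int t *\<^sub>R y \<in> lattice_of A"
proof -
  obtain a b c d where "x = of_int a *\<^sub>R column 1 A + of_int b *\<^sub>R column 2 A"
    "y = of_int c *\<^sub>R column 1 A + of_int d *\<^sub>R column 2 A"
    using assms unfolding lattice_of_columns by blast
  then have "of_int s *\<^sub>R x + of_int t *\<^sub>R y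
     = of_int (s * a + t * c) *\<^sub>R column 1 A + of_int (s * b + t * d) *\<^sub>R column 2 A"
    by (simp add: algebra_simps)
  then show ?thesis unfolding lattice_of_columns by blast
qed

lemma det_sublattice:
  assumes "lattice_of B \<subseteq> lattice_of A"
  shows "\<exists>k::int. det B = of_int k * det A"
proof -
  have "column 1 B \<in> lattice_of A" "column 2 B \<in> lattice_of A"
    using column_in_lattice assms by blast+
  then obtain a b c d where "column 1 B = of_int a *\<^sub>R column 1 A + of_int b *\<^sub>R column 2 A"
    "column 2 B = of_int c *\<^sub>R column 1 A + of_int d *\<^sub>R column 2 A"
    unfolding lattice_of_columns by blast
  then have "det B = of_int (a * d - b * c) * det A"
    by (simp add: det_columns algebra_simps)
  then show ?thesis by blast
qed

text \<open>Each determinant is an integer multiple of the other, and the two integers have product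
  1. This carries the determinant over to a reduced basis.\<close>

lemma abs_det_lattice:
  assumes "lattice_of B = lattice_of A" "det A \<noteq> 0"
  shows "\<bar>det B\<bar> = \<bar>det A\<bar>"
proof -
  obtain k l :: int where k: "det B = of_int k * det A" and l: "det A = of_int l * det B"
    using det_sublattice assms(1) by (metis order_refl)
  have "det A = of_int l * (of_int k * det A)" using l unfolding k .
  then have "of_int (k * l) * det A = 1 * det A" by (simp add: algebra_simps)
  then have "of_int (k * l) = (1::real)" by (rule mult_right_cancel[OF assms(2), THEN iffD1])
  then have "k * l = 1" using of_int_eq_1_iff by blast
  then have "k = 1 \<or> k = - 1" by (auto simp: zmult_eq_1_iff)
  then show ?thesis using k by auto
qed

lemma inner_lattice_Ints:
  assumes "\<forall>i j. (transpose A ** A) $ i $ j \<in> \<int>" "x \<in> lattice_of A" "y \<in> lattice_of A"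
  shows "x \<bullet> y \<in> \<int>"
proof -
  obtain a b c d where "x = of_int a *\<^sub>R column 1 A + of_int b *\<^sub>R column 2 A"
    "y = of_int c *\<^sub>R column 1 A + of_int d *\<^sub>R column 2 A"
    using assms(2,3) unfolding lattice_of_columns by blast
  moreover have "column i A \<bullet> column j A \<in> \<int>" for i j
    using assms(1) by (simp flip: gram_entry)
  ultimately show ?thesis by (simp add: inner_add_left inner_add_right)
qed

text \<open>The squares contribute at most \<open>a / 4\<close> each and the mixed term at most
  \<open>2 * (1 / 4) * (a / 2)\<close>. A remainder after rounding coordinates is thus shorter than
  minimal vectors.\<close>

lemma norm_reduced_remainder:
  fixes x y :: "'a::real_inner"
  assumes "x \<bullet> x = a" "y \<bullet> y = a" "0 \<le> x \<bullet> y" "2 * (x \<bullet> y) \<le> a" "\<bar>s\<bar> \<le> 1 / 2" "\<bar>t\<bar> \<le> 1 / 2"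
  shows "(s *\<^sub>R x + t *\<^sub>R y) \<bullet> (s *\<^sub>R x + t *\<^sub>R y) \<le> 3 / 4 * a"
proof -
  have a: "a \<ge> 0" using assms(1) inner_ge_zero[of x] by simp
  have sq: "s\<^sup>2 \<le> 1 / 4" "t\<^sup>2 \<le> 1 / 4"
    using assms(5,6) abs_le_square_iff[of s "1 / 2"] abs_le_square_iff[of t "1 / 2"]
    by (simp_all add: power2_eq_square)
  have "s * t \<le> \<bar>s\<bar> * \<bar>t\<bar>" by (metis abs_ge_self abs_mult)
  also have "\<dots> \<le> 1 / 2 * (1 / 2)" using assms(5,6) by (intro mult_mono) auto
  finally have "s * t * (x \<bullet> y) \<le> 1 / 2 * (1 / 2) * (x \<bullet> y)"
    using assms(3) by (intro mult_right_mono)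
  then have "s * t * (x \<bullet> y) \<le> 1 / 4 * (a / 2)" using assms(4) by simp
  moreover have "s\<^sup>2 * a \<le> 1 / 4 * a" "t\<^sup>2 * a \<le> 1 / 4 * a"
    using sq a by (simp_all only: mult_right_mono)
  moreover have "(s *\<^sub>R x + t *\<^sub>R y) \<bullet> (s *\<^sub>R x + t *\<^sub>R y) = s\<^sup>2 * a + t\<^sup>2 * a + 2 * (s * t * (x \<bullet> y))"
    using assms(1,2) by (simp add: inner_add_left inner_add_right inner_commute power2_eq_square algebra_simps)
  ultimately show ?thesis by simp
qed

text \<open>A basis of the plane is selected from the spanning minimal vectors, and a sign change
  makes the inner product nonnegative. That it generates the lattice is a separate matter.\<close>

lemma minimal_vectors_basis:
  assumes "well_rounded L" "\<And>x. x \<in> L \<Longrightarrow> - x \<in> L"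
  obtains x y where "x \<in> minimal_vectors L" "y \<in> minimal_vectors L" "x \<bullet> y \<ge> 0"
    "\<And>z. \<exists>s t. z = s *\<^sub>R x + t *\<^sub>R y"
proof -
  have neg: "- y \<in> minimal_vectors L" if "y \<in> minimal_vectors L" for y
    using that assms(2) by (auto simp: minimal_vectors_def)
  obtain B where B: "B \<subseteq> minimal_vectors L" "independent B" "minimal_vectors L \<subseteq> span B"
    using maximal_independent_subset by blast
  then have "span B = UNIV"
    using assms(1) unfolding well_rounded_def by (metis span_mono span_span top.extremum_uniqueI)
  then have "card B = 2" using B(2) dim_eq_card_independent[of B] dim_span[of B] by simp
  then obtain x y where xy: "B = {x, y}" by (meson card_2_iff)
  have gen: "\<exists>s t. z = s *\<^sub>R x + t *\<^sub>R y" for z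
  proof -
    have "z \<in> span {x, y}" using \<open>span B = UNIV\<close> xy by simp
    then obtain s t where "z - s *\<^sub>R x - t *\<^sub>R y = 0" by (auto simp: span_breakdown_eq)
    then show ?thesis by (metis diff_diff_eq right_minus_eq)
  qed
  show thesis
  proof (cases "x \<bullet> y \<ge> 0")
    case True
    then show thesis using that[of x y] B(1) xy gen by auto
  next
    case False
    have "\<exists>s t. z = s *\<^sub>R x + t *\<^sub>R (- y)" for z
      using gen[of z] by (metis minus_minus scaleR_minus_left scaleR_minus_right)
    then show thesis using that[of x "- y"] B(1) xy neg False by auto
  qed
qed

text \<open>For minimal vectors \<open>x\<close> and \<open>y\<close>, minimality against
  \<open>x - y\<close> gives \<open>2 * b \<le> a\<close>. Rounding the coordinates of a lattice
  vector then shows that \<open>x\<close> and \<open>y\<close> generate the lattice.\<close>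

lemma iwr_reduced_basis:
  assumes "L \<in> iwr_lattices \<Delta>"
  obtains B and a b :: int where "det B \<noteq> 0" "L = lattice_of B"
    "column 1 B \<bullet> column 1 B = of_int a" "column 2 B \<bullet> column 2 B = of_int a"
    "column 1 B \<bullet> column 2 B = of_int b" "0 \<le> b" "2 * b \<le> a" "a > 0" "of_int (a\<^sup>2 - b\<^sup>2) = \<Delta>\<^sup>2"
proof -
  obtain A where A: "well_rounded L" "det A \<noteq> 0" "L = lattice_of A"
    "\<forall>i j. (transpose A ** A) $ i $ j \<in> \<int>" "\<bar>det A\<bar> = \<Delta>"
    using assms by (auto simp: iwr_lattices_def)
  have "- x \<in> L" if "x \<in> L" for x
    using lattice_of_closed[of x A x "-1" 0] that A(3) by simp
  then obtain x y where xy: "x \<in> minimal_vectors L" "y \<in> minimal_vectors L" "x \<bullet> y \<ge> 0"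
    and gen: "\<And>z. \<exists>s t. z = s *\<^sub>R x + t *\<^sub>R y"
    using minimal_vectors_basis[OF A(1)] by metis
  have xL: "x \<in> L" "y \<in> L" "x \<noteq> 0" "y \<noteq> 0"
    and min: "\<And>z. z \<in> L \<Longrightarrow> z \<noteq> 0 \<Longrightarrow> norm x \<le> norm z" "norm y \<le> norm x" "norm x \<le> norm y"
    using xy(1,2) by (auto simp: minimal_vectors_def)
  obtain a b :: int where ab: "x \<bullet> x = of_int a" "x \<bullet> y = of_int b"
    using inner_lattice_Ints[OF A(4)] xL A(3) by (meson Ints_cases)
  have yy: "y \<bullet> y = of_int a" using min(2,3) ab(1) by (metis dot_square_norm order_antisym)
  have comb: "of_int s *\<^sub>R x + of_int t *\<^sub>R y \<in> L" for s t :: int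
    using lattice_of_closed xL A(3) by blast
  have short: "z = 0" if "z \<in> L" "z \<bullet> z < of_int a" for z
    using min(1)[OF that(1)] that(2) ab(1) by (metis norm_le not_less)
  have a: "a > 0" using xL(3) ab(1) by (metis inner_gt_zero_iff of_int_0_less_iff)
  have "x \<noteq> y"
  proof
    assume "x = y"
    then have one: "\<exists>s. z = s *\<^sub>R x" for z using gen[of z] by (metis scaleR_add_left)
    \<comment> \<open>With \<open>x = y\<close> the whole plane would lie on one line, against the
      nonzero determinant of \<open>A\<close>.\<close>
    have "column 1 A $ 1 * column 2 A $ 2 = column 2 A $ 1 * column 1 A $ 2"
      using one[of "column 1 A"] one[of "column 2 A"] by auto
    then show False using A(2) by (simp add: det_columns)
  qed
  then have "\<not> (x - y) \<bullet> (x - y) < of_int a"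
    using short[of "x - y"] comb[of 1 "-1"] by auto
  then have "of_int (2 * b) \<le> (of_int a :: real)"
    using ab yy by (simp add: inner_diff_left inner_diff_right inner_commute)
  then have ba: "2 * b \<le> a" by (simp only: of_int_le_iff)
  have b: "0 \<le> b" using xy(3) ab(2) by simp
  define B :: "real^2^2" where "B = (\<chi> i j. if j = 1 then x $ i else y $ i)"
  have col: "column 1 B = x" "column 2 B = y"
    by (simp_all add: B_def column_def vec_eq_iff)
  have LB: "L = lattice_of B"
  proof (intro equalityI subsetI)
    fix z assume "z \<in> lattice_of B"
    then show "z \<in> L" using comb unfolding lattice_of_columns col by blast
  next
    fix z assume z: "z \<in> L"
    obtain s t where st: "z = s *\<^sub>R x + t *\<^sub>R y" using gen by blast
    \<comment> \<open>The remainder \<open>w\<close> is a lattice vector shorter than the minimum,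
      hence zero, so the coordinates of \<open>z\<close> are integers.\<close>
    define w where "w = (s - of_int (round s)) *\<^sub>R x + (t - of_int (round t)) *\<^sub>R y"
    have zw: "w = z - (of_int (round s) *\<^sub>R x + of_int (round t) *\<^sub>R y)"
      by (simp add: w_def st algebra_simps)
    have "w = of_int 1 *\<^sub>R z + of_int (- 1) *\<^sub>R (of_int (round s) *\<^sub>R x + of_int (round t) *\<^sub>R y)"
      unfolding zw by simp
    then have "w \<in> L" using lattice_of_closed comb z A(3) by metis
    moreover have "\<bar>s - of_int (round s)\<bar> \<le> 1 / 2" "\<bar>t - of_int (round t)\<bar> \<le> 1 / 2"
      using of_int_round_abs_le by (metis abs_minus_commute)+
    then have "w \<bullet> w \<le> 3 / 4 * of_int a"
      unfolding w_def using ab yy ba b by (intro norm_reduced_remainder) simp_all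
    then have "w \<bullet> w < of_int a" using a by simp
    ultimately have "w = 0" using short by blast
    then have "z = of_int (round s) *\<^sub>R x + of_int (round t) *\<^sub>R y" using zw by simp
    then show "z \<in> lattice_of B" unfolding lattice_of_columns col by blast
  qed
  have abs: "\<bar>det B\<bar> = \<bar>det A\<bar>" using abs_det_lattice LB A(2,3) by metis
  have "det B \<noteq> 0" using abs A(2) by auto
  moreover have "(det B)\<^sup>2 = \<Delta>\<^sup>2" using abs A(5) by (metis power2_abs)
  moreover have "(det B)\<^sup>2 = of_int (a\<^sup>2 - b\<^sup>2)"
    unfolding det_square_gram col by (simp add: ab yy power2_eq_square)
  ultimately show thesis using that[of B a b] LB ab yy b ba a col by simp
qed

text \<open>The map taking one basis to the other is \<open>B'\<close> times the inverse of
  \<open>B\<close>; equality of the Gram matrices makes it orthogonal.\<close>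

lemma isometric_if_same_gram:
  assumes "det B \<noteq> 0" "transpose B ** B = transpose B' ** (B' :: real^2^2)"
  shows "\<exists>U. orthogonal_matrix U \<and> lattice_of B' = (\<lambda>x. U *v x) ` lattice_of B"
proof -
  obtain C where C: "B ** C = mat 1" "C ** B = mat 1"
    using assms(1) invertible_det_nz[of B] unfolding invertible_def by blast
  define U where "U = B' ** C"
  have "transpose U ** U = transpose C ** (transpose B' ** B') ** C"
    by (simp add: U_def matrix_transpose_mul matrix_mul_assoc)
  also have "\<dots> = transpose (B ** C) ** (B ** C)"
    unfolding assms(2)[symmetric] by (simp add: matrix_transpose_mul matrix_mul_assoc)
  finally have "orthogonal_matrix U" by (simp add: C orthogonal_matrix)
  moreover have "U *v (B *v z) = B' *v z" for z
    by (metis C(2) U_def matrix_mul_assoc matrix_mul_rid matrix_vector_mul_assoc)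
  then have "lattice_of B' = (\<lambda>x. U *v x) ` lattice_of B"
    by (auto simp: lattice_of_def image_iff) metis+
  ultimately show ?thesis by blast
qed

section \<open>Isometry classes and their count by divisors\<close>

lemma equiv_isometry_rel: "equiv (iwr_lattices \<Delta>) (isometry_rel \<Delta>)"
proof (rule equivI)
  show "isometry_rel \<Delta> \<subseteq> iwr_lattices \<Delta> \<times> iwr_lattices \<Delta>" by (auto simp: isometry_rel_def)
  show "refl_on (iwr_lattices \<Delta>) (isometry_rel \<Delta>)"
    unfolding refl_on_def isometry_rel_def using orthogonal_matrix_id
    by (auto intro!: exI[of _ "mat 1 :: real^2^2"])
  show "sym (isometry_rel \<Delta>)"
  proof (rule symI)
    fix L L' assume "(L, L') \<in> isometry_rel \<Delta>"
    then obtain U where U: "L \<in> iwr_lattices \<Delta>" "L' \<in> iwr_lattices \<Delta>"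
      "orthogonal_matrix U" "L' = (\<lambda>x. U *v x) ` L" by (auto simp: isometry_rel_def)
    have "transpose U *v (U *v x) = x" for x
      using U(3) by (simp only: matrix_vector_mul_assoc orthogonal_matrix matrix_vector_mul_lid)
    then have "L = (\<lambda>x. transpose U *v x) ` L'" unfolding U(4) image_image by simp
    then show "(L', L) \<in> isometry_rel \<Delta>"
      using U by (auto simp: isometry_rel_def intro!: exI[of _ "transpose U"])
  qed
  show "trans (isometry_rel \<Delta>)"
  proof (rule transI)
    fix L L' L'' assume "(L, L') \<in> isometry_rel \<Delta>" "(L', L'') \<in> isometry_rel \<Delta>"
    then obtain U V where U: "L \<in> iwr_lattices \<Delta>" "L'' \<in> iwr_lattices \<Delta>"
      "orthogonal_matrix U" "L' = (\<lambda>x. U *v x) ` L" "orthogonal_matrix V" "L'' = (\<lambda>x. V *v x) ` L'"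
      by (auto simp: isometry_rel_def)
    then have "orthogonal_matrix (V ** U)" "L'' = (\<lambda>x. (V ** U) *v x) ` L"
      by (auto simp: orthogonal_matrix_mul image_image matrix_vector_mul_assoc)
    then show "(L, L'') \<in> isometry_rel \<Delta>" using U(1,2) by (auto simp: isometry_rel_def)
  qed
qed

text \<open>With \<open>u = a - b\<close> and \<open>N / u = a + b\<close>, the reduction condition
  \<open>0 \<le> 2 * b \<le> a\<close> becomes \<open>u \<le> N / u \<le> 3 * u\<close>; multiplying
  by \<open>u\<close> removes the division.\<close>

definition balanced_divisors :: "nat \<Rightarrow> nat set" where
  "balanced_divisors N = {u. u dvd N \<and> u\<^sup>2 \<le> N \<and> N \<le> 3 * u\<^sup>2}"

text \<open>Given \<open>N\<close>, the divisor \<open>u = a - b\<close> fixes \<open>a + b\<close>,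
  hence the Gram matrix of the reduced basis and the isometry class.\<close>

lemma card_IWR_le:
  assumes "real N = \<Delta>\<^sup>2" "N > 0"
  shows "finite (IWR \<Delta>)" "card (IWR \<Delta>) \<le> card (balanced_divisors N)"
proof -
  define P where "P L u \<longleftrightarrow> (\<exists>B a b. det B \<noteq> 0 \<and> L = lattice_of B \<and>
    column 1 B \<bullet> column 1 B = of_int a \<and> column 2 B \<bullet> column 2 B = of_int a \<and>
    column 1 B \<bullet> column 2 B = of_int b \<and> int u = a - b \<and> int u * (a + b) = int N)" for L u
  have ex: "\<exists>u\<in>balanced_divisors N. P L u" if L: "L \<in> iwr_lattices \<Delta>" for L
  proof -
    obtain B and a b :: int where B: "det B \<noteq> 0" "L = lattice_of B"
      "column 1 B \<bullet> column 1 B = of_int a" "column 2 B \<bullet> column 2 B = of_int a"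
      "column 1 B \<bullet> column 2 B = of_int b" "0 \<le> b" "2 * b \<le> a" "a > 0" "of_int (a\<^sup>2 - b\<^sup>2) = \<Delta>\<^sup>2"
      using iwr_reduced_basis[OF L] by metis
    define u v where "u = nat (a - b)" and "v = nat (a + b)"
    have u: "int u = a - b" "int v = a + b" using B(6-8) by (simp_all add: u_def v_def)
    have "real_of_int (a\<^sup>2 - b\<^sup>2) = of_int (int N)" using B(9) assms(1) by simp
    then have "a\<^sup>2 - b\<^sup>2 = int N" by (simp only: of_int_eq_iff)
    then have N: "int u * (a + b) = int N" unfolding u by (simp add: power2_eq_square algebra_simps)
    then have uv: "u * v = N" unfolding u(2)[symmetric] by (metis of_nat_eq_iff of_nat_mult)
    have "int u \<le> int v" "int v \<le> 3 * int u" unfolding u using B(6-8) by auto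
    then have "u \<le> v" "v \<le> 3 * u" by linarith+
    then have "u * u \<le> u * v" "u * v \<le> u * (3 * u)" by (intro mult_left_mono; simp)+
    then have "u \<in> balanced_divisors N"
      using uv by (auto simp: balanced_divisors_def power2_eq_square)
    moreover have "P L u" unfolding P_def using B(1-5) u(1) N by blast
    ultimately show ?thesis by blast
  qed
  have uniq: "(L, L') \<in> isometry_rel \<Delta>"
    if L: "L \<in> iwr_lattices \<Delta>" "L' \<in> iwr_lattices \<Delta>" and P: "P L u" "P L' u" for L L' u
  proof -
    obtain B a b where B: "det B \<noteq> 0" "L = lattice_of B"
      "column 1 B \<bullet> column 1 B = of_int a" "column 2 B \<bullet> column 2 B = of_int a"
      "column 1 B \<bullet> column 2 B = of_int b" "int u = a - b" "int u * (a + b) = int N"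
      using P(1) unfolding P_def by blast
    obtain B' a' b' where B': "L' = lattice_of B'"
      "column 1 B' \<bullet> column 1 B' = of_int a'" "column 2 B' \<bullet> column 2 B' = of_int a'"
      "column 1 B' \<bullet> column 2 B' = of_int b'" "int u = a' - b'" "int u * (a' + b') = int N"
      using P(2) unfolding P_def by blast
    have "int u \<noteq> 0" using B(7) assms(2) by (metis mult_zero_left of_nat_0_eq_iff less_irrefl)
    then have "a + b = a' + b'" using B(7) B'(6) by (metis mult_left_cancel)
    then have "a = a'" "b = b'" using B(6) B'(5) by linarith+
    then have "(transpose B ** B) $ i $ j = (transpose B' ** B') $ i $ j" for i j
      unfolding gram_entry using B(3-5) B'(2-4) exhaust_2[of i] exhaust_2[of j]
      by (auto simp: inner_commute)
    then have "transpose B ** B = transpose B' ** B'" by (simp add: vec_eq_iff)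
    then show ?thesis
      using isometric_if_same_gram[OF B(1)] L B(2) B'(1) by (auto simp: isometry_rel_def)
  qed
  \<comment> \<open>One lattice is chosen for each \<open>u\<close>. Where none fits the choice is
    arbitrary, which is harmless since only an upper bound for the image is taken.\<close>
  define g where "g u = isometry_rel \<Delta> `` {SOME L. L \<in> iwr_lattices \<Delta> \<and> P L u}" for u
  have sub: "IWR \<Delta> \<subseteq> g ` balanced_divisors N"
  proof
    fix X assume "X \<in> IWR \<Delta>"
    then obtain L where L: "L \<in> iwr_lattices \<Delta>" "X = isometry_rel \<Delta> `` {L}"
      unfolding IWR_def by (rule quotientE)
    obtain u where u: "u \<in> balanced_divisors N" "P L u" using ex L(1) by blast
    define L' where "L' = (SOME L. L \<in> iwr_lattices \<Delta> \<and> P L u)"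
    have "L' \<in> iwr_lattices \<Delta> \<and> P L' u"
      unfolding L'_def by (rule someI[of _ L]) (use L u in blast)
    then have "X = g u"
      using uniq L u(2) equiv_class_eq[OF equiv_isometry_rel] unfolding g_def L'_def by blast
    then show "X \<in> g ` balanced_divisors N" using u(1) by blast
  qed
  have fin: "finite (balanced_divisors N)"
    unfolding balanced_divisors_def using assms(2) by (intro finite_subset[OF _ finite_divisors_nat[of N]]) auto
  show "finite (IWR \<Delta>)" using sub fin finite_surj by blast
  show "card (IWR \<Delta>) \<le> card (balanced_divisors N)" using sub fin surj_card_le by blast
qed

section \<open>Balanced divisors\<close>

lemma gcd_factors_squarefree_square:
  fixes u v :: nat
  assumes "u > 0" "v > 0"
  obtains c d e s t where "u = c * (d * s\<^sup>2)" "v = c * (e * t\<^sup>2)" "coprime (d * s\<^sup>2) (e * t\<^sup>2)"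
    "squarefree d" "squarefree e"
proof -
  obtain x y where "u = gcd u v * x" "v = gcd u v * y" "coprime x y"
    using gcd_coprime_exists[of u v] assms by (metis gcd_eq_0_iff less_irrefl mult.commute)
  then show thesis
    using that[of "gcd u v" "squarefree_part x" "square_part x" "squarefree_part y" "square_part y"]
      squarefree_decompose[of x] squarefree_decompose[of y] by simp
qed

text \<open>With \<open>D = d e\<close> the pair \<open>m = e t\<close>, \<open>n = s\<close> is the reduced form of \<open>m / n = \<surd>D \<surd>(v / u)\<close>.\<close>

lemma mn_set_nonempty:
  assumes "u > 0" "u \<le> 3 * v" "v \<le> 3 * u" "even (u + v)"
  shows "\<exists>M D. M > 0 \<and> D > 0 \<and> squarefree D \<and> u * v = M\<^sup>2 * D \<and> mn_set D M \<noteq> {}"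
proof -
  have "v > 0" using assms(1,2) by auto
  then obtain c d e s t where u: "u = c * (d * s\<^sup>2)" and v: "v = c * (e * t\<^sup>2)"
    and cop: "coprime (d * s\<^sup>2) (e * t\<^sup>2)" and sf: "squarefree d" "squarefree e"
    using gcd_factors_squarefree_square[OF assms(1)] by metis
  have pos: "c > 0" "d > 0" "e > 0" "s > 0" "t > 0"
    using u v assms(1) \<open>v > 0\<close> by (auto intro!: Nat.gr0I)
  have cop': "coprime d e" "coprime d t" "coprime s e" "coprime s t"
    using cop by auto
  define D M where "D = d * e" and "M = c * (s * t)"
  have "gcd (e * t) s = 1" using cop' by (simp add: coprime_commute flip: coprime_iff_gcd_eq_1)
  moreover have "sqrt (real D / 3) \<le> real (e * t) / real s"
  proof (rule real_le_lsqrt)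
    have "d * s\<^sup>2 \<le> 3 * (e * t\<^sup>2)" using assms(2) u v pos by simp
    then have "real (e * (d * s\<^sup>2)) \<le> real (e * (3 * (e * t\<^sup>2)))"
      by (intro of_nat_mono mult_left_mono) auto
    then show "real D / 3 \<le> (real (e * t) / real s)\<^sup>2"
      using pos by (simp add: D_def power_divide divide_simps power2_eq_square algebra_simps)
  qed auto
  moreover have "real (e * t) / real s \<le> sqrt (3 * real D)"
  proof (rule real_le_rsqrt)
    have "e * t\<^sup>2 \<le> 3 * (d * s\<^sup>2)" using assms(3) u v pos by simp
    then have "real (e * (e * t\<^sup>2)) \<le> real (e * (3 * (d * s\<^sup>2)))"
      by (intro of_nat_mono mult_left_mono) auto
    then show "(real (e * t) / real s)\<^sup>2 \<le> 3 * real D"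
      using pos by (simp add: D_def power_divide divide_simps power2_eq_square algebra_simps)
  qed
  \<comment> \<open>Here \<open>gcd (e * t) D\<close> is \<open>e\<close>, so the quotient is
    \<open>2 * s * t\<close> or \<open>s * t\<close>, to be compared with
    \<open>M = c * s * t\<close>.\<close>
  moreover have "(2 * (e * t) * s) div (2 ^ parity_exponent D (e * t) s * gcd (e * t) D) dvd M"
  proof -
    have "gcd (e * t) D = gcd (e * t) (e * d)" by (simp add: D_def mult.commute)
    also have "\<dots> = e" using cop'(2) by (simp add: gcd_mult_distrib_nat[symmetric] coprime_commute)
    finally have g: "gcd (e * t) D = e" .
    have "2 * (e * t) * s = (2 * (s * t)) * e" by simp
    then have "(2 * (e * t) * s) div (2 ^ i * e) = (2 * (s * t)) div 2 ^ i" for i :: nat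
      using pos(3) by (simp only: div_mult_mult2)
    then have eq: "(2 * (e * t) * s) div (2 ^ parity_exponent D (e * t) s * gcd (e * t) D)
        = (2 * (s * t)) div 2 ^ parity_exponent D (e * t) s" using g by simp
    show ?thesis
    proof (cases "parity_exponent D (e * t) s = 0")
      case True
      \<comment> \<open>In this case exactly one of the two coprime cofactors is even. As
        \<open>u + v\<close> is even, the common factor \<open>c\<close> must supply the missing
        2.\<close>
      then have "even D \<or> even (D + 1) \<and> even (e * t * s)"
        by (auto simp: parity_exponent_def split: if_splits)
      then have "even ((d * s\<^sup>2) * (e * t\<^sup>2))" by (auto simp: D_def)
      moreover have "\<not> (even (d * s\<^sup>2) \<and> even (e * t\<^sup>2))"
        using cop coprime_common_divisor[of "d * s\<^sup>2" "e * t\<^sup>2" 2] by auto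
      ultimately have "odd (d * s\<^sup>2 + e * t\<^sup>2)" by auto
      moreover have "even (c * (d * s\<^sup>2 + e * t\<^sup>2))"
        using assms(4) unfolding u v by (simp only: distrib_left)
      ultimately have "even c" by (metis even_mult_iff)
      then show ?thesis unfolding eq by (simp add: True M_def mult_dvd_mono)
    next
      case False
      then have "parity_exponent D (e * t) s = 1" by (auto simp: parity_exponent_def split: if_splits)
      then show ?thesis unfolding eq by (simp add: M_def)
    qed
  qed
  ultimately have "(e * t, s) \<in> mn_set D M"
    using pos by (simp add: mn_set_def)
  moreover have "squarefree D" unfolding D_def using cop'(1) sf by (rule squarefree_mult_coprime)
  moreover have "u * v = M\<^sup>2 * D" by (simp add: u v M_def D_def power2_eq_square algebra_simps)
  moreover have "M > 0" "D > 0" using pos by (auto simp: M_def D_def)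
  ultimately show ?thesis by blast
qed

text \<open>The numbers \<open>a - b\<close> and \<open>a + b\<close> of a reduced basis have the
  even sum \<open>2 * a\<close> and product \<open>\<Delta>\<^sup>2\<close>, so
  \<open>mn_set_nonempty\<close> applies to them.\<close>

lemma IWR_nonempty_imp:
  assumes "\<Delta> > 0" "IWR \<Delta> \<noteq> {}"
  shows "\<exists>M D. M > 0 \<and> D > 0 \<and> squarefree D \<and> \<Delta> = real M * sqrt (real D) \<and> mn_set D M \<noteq> {}"
proof -
  obtain L where "L \<in> iwr_lattices \<Delta>" using assms(2) by (auto simp: IWR_def quotient_def)
  then obtain a b :: int where ab: "0 \<le> b" "2 * b \<le> a" "a > 0" "of_int (a\<^sup>2 - b\<^sup>2) = \<Delta>\<^sup>2"
    using iwr_reduced_basis by metis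
  define u v where "u = nat (a - b)" and "v = nat (a + b)"
  have uv: "int u = a - b" "int v = a + b" using ab by (simp_all add: u_def v_def)
  have "int (u + v) = 2 * a" using uv by simp
  then have "even (u + v)" by (metis dvd_triv_left even_of_nat)
  moreover have "u > 0" "u \<le> 3 * v" "v \<le> 3 * u" using uv ab by linarith+
  ultimately obtain M D where MD: "M > 0" "D > 0" "squarefree D" "u * v = M\<^sup>2 * D" "mn_set D M \<noteq> {}"
    using mn_set_nonempty by metis
  have "int (u * v) = a\<^sup>2 - b\<^sup>2" by (simp add: uv power2_eq_square algebra_simps)
  then have "\<Delta>\<^sup>2 = real (u * v)" using ab(4) by (metis of_int_of_nat_eq)
  also have "\<dots> = (real M * sqrt (real D))\<^sup>2" by (simp add: MD(4) power_mult_distrib)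
  finally have "\<Delta> = real M * sqrt (real D)" using assms(1) by (simp add: power2_eq_iff_nonneg)
  then show ?thesis using MD by blast
qed

text \<open>The injection taking \<open>u\<close> to \<open>N div u\<close> sends these divisors
  above the square root, giving as many further divisors.\<close>

lemma card_divisors_below_sqrt:
  assumes "N > 0"
  shows "2 * card {u. u dvd N \<and> u\<^sup>2 < N} \<le> tau N"
proof -
  define P where "P = {u. u dvd N \<and> u\<^sup>2 < N}"
  have fin: "finite {u. u dvd N}" using assms by simp
  have finP: "finite P" using fin by (rule finite_subset[rotated]) (auto simp: P_def)
  have large: "N < (N div u)\<^sup>2" if u: "u \<in> P" for u
  proof -
    obtain v where v: "N = u * v" using u by (auto simp: P_def)
    have "u * u < u * v" using u v by (auto simp: P_def power2_eq_square)
    then have "u < v" "u > 0" by (auto intro: Nat.gr0I)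
    then have "u * v < v * v" by simp
    then show ?thesis using v \<open>u > 0\<close> by (simp add: power2_eq_square)
  qed
  have "inj_on (\<lambda>u. N div u) P"
  proof (rule inj_onI)
    fix x y assume "x \<in> P" "y \<in> P" "N div x = N div y"
    then have "x * (N div y) = N" "y * (N div y) = N"
      unfolding P_def by (metis (mono_tags, lifting) dvd_mult_div_cancel mem_Collect_eq)+
    then show "x = y" using assms by (metis mult_cancel2 mult_0_right less_irrefl)
  qed
  then have "card ((\<lambda>u. N div u) ` P) = card P" by (rule card_image)
  moreover have "P \<inter> (\<lambda>u. N div u) ` P = {}" using large by (force simp: P_def)
  ultimately have "2 * card P = card (P \<union> (\<lambda>u. N div u) ` P)"
    using finP by (simp add: card_Un_disjoint)
  also have "\<dots> \<le> tau N" unfolding tau_def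
    using fin by (intro card_mono) (auto simp: P_def)
  finally show ?thesis by (simp add: P_def)
qed

text \<open>If \<open>N\<close> is a square, its root is exchanged for the divisor 1, which is balanced only for \<open>N \<le> 3\<close>.\<close>

lemma card_balanced_divisors_le_half:
  assumes "N > 1"
  shows "2 * card (balanced_divisors N) \<le> tau N"
proof -
  define P where "P = {u. u dvd N \<and> u\<^sup>2 < N}"
  have fin: "finite P" unfolding P_def
    using assms by (intro finite_subset[OF _ finite_divisors_nat[of N]]) auto
  have "card (balanced_divisors N) \<le> card P"
  proof (cases "\<exists>w\<in>balanced_divisors N. w\<^sup>2 = N")
    case False
    then have "balanced_divisors N \<subseteq> P" by (force simp: balanced_divisors_def P_def)
    then show ?thesis using fin card_mono by blast
  next
    case True
    then obtain w where w: "w\<^sup>2 = N" by blast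
    then have "w \<ge> 2" using assms by (cases "w = 0 \<or> w = 1") auto
    then have "2\<^sup>2 \<le> N" unfolding w[symmetric] by (rule power_mono) simp
    have "balanced_divisors N \<subseteq> insert w (P - {1})"
    proof
      fix u assume u: "u \<in> balanced_divisors N"
      show "u \<in> insert w (P - {1})"
      proof (cases "u\<^sup>2 = N")
        case True
        then have "u = w" using w by (metis power2_eq_iff_nonneg zero_le)
        then show ?thesis by simp
      next
        case False
        then show ?thesis using u \<open>2\<^sup>2 \<le> N\<close> by (auto simp: balanced_divisors_def P_def)
      qed
    qed
    then have "card (balanced_divisors N) \<le> card (insert w (P - {1}))"
      using fin by (intro card_mono) auto
    also have "\<dots> \<le> Suc (card (P - {1}))" by (rule card_insert_le_m1) auto
    \<comment> \<open>Since \<open>N > 1\<close>, the divisor 1 lies in \<open>P\<close>; leaving it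
      out pays for the added root \<open>w\<close>.\<close>
    also have "\<dots> = card P"
      using fin assms by (intro card.remove[symmetric]) (auto simp: P_def)
    finally show ?thesis .
  qed
  then show ?thesis using card_divisors_below_sqrt[of N] assms by (simp add: P_def)
qed

text \<open>The quotient \<open>k\<close> satisfies
  \<open>x\<^sup>2 * k\<^sup>2 \<le> N \<le> 3 * x\<^sup>2\<close>, so \<open>k < 2\<close>.\<close>

lemma balanced_divisors_antichain:
  assumes "N > 0" "x \<in> balanced_divisors N" "y \<in> balanced_divisors N" "x dvd y"
  shows "x = y"
proof -
  obtain k where k: "y = x * k" using assms(4) by blast
  have "y > 0" using assms(1,3) by (auto simp: balanced_divisors_def intro: Nat.gr0I)
  then have "k > 0" "x > 0" using k by (auto intro: Nat.gr0I)
  moreover have "\<not> k \<ge> 2"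
  proof
    assume "k \<ge> 2"
    then have "x\<^sup>2 * 2\<^sup>2 \<le> x\<^sup>2 * k\<^sup>2" by (intro mult_left_mono power_mono) auto
    also have "\<dots> = y\<^sup>2" by (simp add: k power_mult_distrib)
    also have "\<dots> \<le> 3 * x\<^sup>2" using assms(2,3) by (auto simp: balanced_divisors_def)
    finally show False using \<open>x > 0\<close> by simp
  qed
  ultimately have "k = 1" by linarith
  then show ?thesis using k by simp
qed

lemma card_balanced_divisors_le_weight:
  assumes "M > 0" "D > 0"
  shows "real (card (balanced_divisors (M\<^sup>2 * D))) \<le> 2 * divisor_weight D M"
proof -
  define N w where "N = M\<^sup>2 * D" and "w = real (omega (M * D))"
  have N: "N > 0" using assms by (simp add: N_def)
  have "{p. prime p \<and> p dvd N} = {p. prime p \<and> p dvd M * D}"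
    by (auto simp: N_def prime_dvd_mult_iff prime_dvd_power_iff)
  then have w: "real (omega N) = w" by (simp add: omega_def w_def)
  have "real (card (balanced_divisors N)) \<le> real (tau N) / sqrt (1 + w / 3)"
    unfolding w[symmetric] using N balanced_divisors_antichain[OF N]
    by (intro divisor_antichain_le) (auto simp: balanced_divisors_def)
  also have "\<dots> \<le> real (tau N) / (sqrt (max 1 w) / 2)"
  proof (rule divide_left_mono)
    \<comment> \<open>The factor 4 covers both arguments of the maximum; its root is the constant 2
      of the final estimate.\<close>
    have "sqrt (max 1 w) \<le> sqrt (4 * (1 + w / 3))"
      by (rule real_sqrt_le_mono) (simp add: w_def)
    also have "\<dots> = 2 * sqrt (1 + w / 3)" by (simp only: real_sqrt_mult real_sqrt_four)
    finally show "sqrt (max 1 w) / 2 \<le> sqrt (1 + w / 3)" by simp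
  qed (auto simp: w_def intro!: mult_pos_pos add_pos_nonneg)
  also have "\<dots> = 2 * divisor_weight D M"
    by (simp add: divisor_weight_def N_def w_def of_nat_max)
  finally show ?thesis by (simp add: N_def)
qed

theorem theorem1p4:
  shows "(\<forall>\<Delta>::real. \<Delta> > 0 \<longrightarrow> finite (IWR \<Delta>)) \<and>
    (\<forall>\<Delta>::real. \<Delta> > 0 \<longrightarrow> IWR \<Delta> \<noteq> {} \<longrightarrow>
       (\<exists>M D :: nat. M > 0 \<and> D > 0 \<and> squarefree D \<and> \<Delta> = real M * sqrt (real D) \<and> mn_set D M \<noteq> {})) \<and>
    (\<forall>(\<Delta>::real) (M::nat) (D::nat).
       \<Delta> > 0 \<longrightarrow> M > 0 \<longrightarrow> D > 0 \<longrightarrow> squarefree D \<longrightarrow> \<Delta> = real M * sqrt (real D) \<longrightarrow> mn_set D M \<noteq> {} \<longrightarrow>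
       \<Delta> \<noteq> 1 \<longrightarrow>
       real (card (IWR \<Delta>)) \<le> 1 / 2 * (\<Sum>r | r dvd M. 2 ^ omega (r * D))) \<and>
    (\<exists>C::real. C > 0 \<and> (\<forall>(\<Delta>::real) (M::nat) (D::nat).
       \<Delta> > 0 \<longrightarrow> M > 0 \<longrightarrow> D > 0 \<longrightarrow> squarefree D \<longrightarrow> \<Delta> = real M * sqrt (real D) \<longrightarrow> mn_set D M \<noteq> {} \<longrightarrow>
       real (card (IWR \<Delta>)) \<le>
         C * (\<Sum>r | r dvd M. \<Sum>g | g dvd r. of_int (mu (r div g)) * divisor_weight D g)))"
proof -
  have N: "real (M\<^sup>2 * D) = \<Delta>\<^sup>2 \<and> M\<^sup>2 * D > 0"
    if "M > 0" "D > 0" "\<Delta> = real M * sqrt (real D)" for \<Delta> and M D :: nat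
    using that by (simp add: power_mult_distrib)
  show ?thesis
  proof (intro conjI allI impI exI[of _ "2::real"])
    fix \<Delta> :: real assume pos: "\<Delta> > 0"
    show "finite (IWR \<Delta>)"
    \<comment> \<open>Only a nonempty \<open>IWR \<Delta>\<close> guarantees that
      \<open>\<Delta>\<^sup>2\<close> is an integer.\<close>
    proof (cases "IWR \<Delta> = {}")
      case False
      then obtain M D where "M > 0" "D > 0" "\<Delta> = real M * sqrt (real D)"
        using IWR_nonempty_imp[OF pos] by blast
      then show ?thesis using N card_IWR_le(1) by blast
    qed simp
    assume "IWR \<Delta> \<noteq> {}"
    then show "\<exists>M D :: nat. M > 0 \<and> D > 0 \<and> squarefree D \<and> \<Delta> = real M * sqrt (real D) \<and> mn_set D M \<noteq> {}"
      using IWR_nonempty_imp[OF pos] by blast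
  next
    fix \<Delta> :: real and M D :: nat
    assume MD: "M > 0" "D > 0" "squarefree D" "\<Delta> = real M * sqrt (real D)" and "\<Delta> \<noteq> 1"
    \<comment> \<open>For \<open>N = 1\<close> the halved divisor count would fail: the divisor 1 is
      balanced and is the only one.\<close>
    then have "M\<^sup>2 * D \<noteq> 1" by auto
    then have "M\<^sup>2 * D > 1" using N MD by (metis less_one nat_neq_iff)
    then have "2 * card (IWR \<Delta>) \<le> tau (M\<^sup>2 * D)"
      using card_IWR_le(2)[of "M\<^sup>2 * D" \<Delta>] card_balanced_divisors_le_half[of "M\<^sup>2 * D"] N[of M D \<Delta>] MD by simp
    also have "\<dots> \<le> (\<Sum>r | r dvd M. 2 ^ omega (r * D))" using MD by (intro tau_square_mult_le)
    finally have "real (2 * card (IWR \<Delta>)) \<le> real (\<Sum>r | r dvd M. 2 ^ omega (r * D))"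
      by (simp only: of_nat_le_iff)
    then show "real (card (IWR \<Delta>)) \<le> 1 / 2 * (\<Sum>r | r dvd M. 2 ^ omega (r * D))" by simp
  next
    fix \<Delta> :: real and M D :: nat
    assume MD: "M > 0" "D > 0" "\<Delta> = real M * sqrt (real D)"
    have "real (card (IWR \<Delta>)) \<le> real (card (balanced_divisors (M\<^sup>2 * D)))"
      using card_IWR_le(2)[of "M\<^sup>2 * D" \<Delta>] N[of M D \<Delta>] MD by simp
    also have "\<dots> \<le> 2 * divisor_weight D M" using MD by (intro card_balanced_divisors_le_weight)
    also have "divisor_weight D M = (\<Sum>r | r dvd M. \<Sum>g | g dvd r. of_int (mu (r div g)) * divisor_weight D g)"
      using MD by (intro moebius_inversion[symmetric])
    finally show "real (card (IWR \<Delta>)) \<le>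
        2 * (\<Sum>r | r dvd M. \<Sum>g | g dvd r. of_int (mu (r div g)) * divisor_weight D g)" .
  qed simp
qed

end
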